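(* Fix a finite-memory policy tuple $\delta=(\delta^L,\delta^{F_1},\delta^{F_2})$ and let $v^L(\zeta^L,y^L)=v^L_\delta(\zeta^L,y^L)$ denote the leader's value function in the three-agent game described in the context, with communication parameters $(\epsilon_1,\epsilon_2)$. There is a unique real-valued function $g^L$ on the set $\{\zeta\}$ of joint information histories satisfying $$v^L(\zeta^L,y^L)=\sum_{\zeta^F}y^L(\zeta^F)\,g^L(\zeta^L,\zeta^F)$$ (for all leader histories $\zeta^L$ and all beliefs $y^L$). Furthermore, $g^L$ can be represented by a double sequence $\{\alpha^{k,l}\}_{k,l\ge 0}$ of real-valued vectors over $\{\zeta\}$ (not depending on $\epsilon_1,\epsilon_2$) as a power series $$g^L=\sum_{k=0}^\infty\sum_{l=0}^\infty \epsilon_1^k\epsilon_2^l\,\alpha^{k,l},$$ where the series converges for: (i) all $0<\epsilon_1,\epsilon_2<1$, if $0<\beta\le 1/9$; (ii) all $0<\epsilon_1,\epsilon_2<\frac{1-\beta}{8\beta}$, if $1/9<\beta<1$. Hence, on these ranges, $v^L(\zeta^L,y^L)$ is infinitely differentiable in $\epsilon_1,\epsilon_2$.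
   Context: Game. There are three agents: a leader $L$ and two followers $F_1,F_2$; time is $t=0,1,2,\dots$. The finite state spaces are $S^L=S^L_1\times S^L_2$, $S^{F_1}$, $S^{F_2}$; put $S^F=S^{F_1}\times S^{F_2}$, $S=S^L\times S^F$, and write a state as $s=(s^L_1,s^L_2,s^F)$. The action spaces $A^L,A^{F_1},A^{F_2}$ are finite and $a=(a^L,a^{F_1},a^{F_2})$ is a joint action. The state evolves according to given probabilities $P(s'|s,a)$. The discount factor is $\beta\in[0,1)$ and agent $k$ receives reward $r^k(s(t),a(t))$ at time $t$. Communication. The leader observes the full state $s$. Follower $i\in\{1,2\}$ observes $s^L_i$ and $s^F$ exactly, and learns about $s^L_{3-i}$ only via a message $z^{F_i}\in Z^{F_i}:=S^L_{3-i}$ from the other follower. Given the current state, the two messages are generated independently of each other and of the past, so $P(z',s'|s,a)=P(s'|s,a)\prod_{i=1}^2Q^i(z'^{F_i}|s'^L_{3-i})$, where $$Q^i(z^{F_i}|s^L_{3-i})=\begin{cases}1-\epsilon_i & z^{F_i}=s^L_{3-i},\\ \epsilon_i\,\sigma_{s^L_{3-i},z^{F_i}} & z^{F_i}\ne s^L_{3-i},\end{cases}$$ with fixed $\sigma_{s,z}\ge 0$, $\sigma_{s,s}=0$, $\sum_z\sigma_{s,z}=1$ for each $s$. Histories and policies. Set $\bar z^L=s^F$ and $\bar z^{F_i}=(s^L_i,z^{F_i},s^{F_{3-i}})$. For a fixed finite memory length $\tau$, agent $k$'s (private) information history at time $t$ is $\zeta^k(t,\tau)=\{s^k(t),\dots,s^k(t-\tau+1),\bar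 z^k(t),\dots,\bar z^k(t-\tau+1),a^k(t-1),\dots,a^k(t-\tau)\}$; time arguments are suppressed. A joint information history is $\zeta=(\zeta^L,\zeta^{F})$, $\zeta^F=(\zeta^{F_1},\zeta^{F_2})$, and $\{\zeta\}$ is the (finite) set of these; the current state $s$ is determined by $\zeta$. A finite-memory policy $\delta^k$ of agent $k$ selects $a^k(t)$ on the basis of $\zeta^k(t,\tau)$, i.e. according to a distribution $P(a^k|\zeta^k)$; under $\delta=(\delta^L,\delta^{F_1},\delta^{F_2})$, $P(a|\zeta)=\prod_kP(a^k|\zeta^k)$. Value function. A belief $y^L$ is a probability distribution over $\zeta^F$, representing the conditional distribution of $\zeta^F$ given the leader's information. $v^L_\delta(\zeta^L,y^L)$ is the infinite-horizon expected total discounted reward $E\{\sum_t\beta^tr^L(s(t),a(t))\}$ under $\delta$ when the leader's initial history is $\zeta^L$ and the followers' initial histories $\zeta^F$ are distributed according to $y^L$. *)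

theory Defs
  imports "HOL-Probability.Probability"
begin

section \<open>Path measures of Markov chains\<close>

definition path_kernel :: "'x pmf \<Rightarrow> ('x \<Rightarrow> 'x pmf) \<Rightarrow> nat \<Rightarrow> (nat \<Rightarrow> 'x) \<Rightarrow> 'x measure" where
  "path_kernel \<mu> K n \<omega> = measure_pmf (if n = 0 then \<mu> else K (\<omega> (n - 1)))"

lemma Ionescu_Tulcea_path_kernel: "Ionescu_Tulcea (path_kernel \<mu> K) (\<lambda>_. count_space UNIV)"
proof (rule Ionescu_Tulcea.intro)
  fix n :: nat
  let ?M = "PiM {0..<n} (\<lambda>_. count_space UNIV)"
  let ?S = "subprob_algebra (count_space UNIV)"
  show "path_kernel \<mu> K n \<in> measurable ?M ?S"
  proof (cases "n = 0")
    case True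
    then have "path_kernel \<mu> K n = (\<lambda>_. measure_pmf \<mu>)"
      by (simp add: path_kernel_def fun_eq_iff)
    then show ?thesis
      by (simp only:) (rule measurable_const, rule measure_pmf_in_subprob_algebra)
  next
    case False
    then have "n - 1 \<in> {0..<n}" by auto
    then have 1: "(\<lambda>\<omega>. \<omega> (n - 1)) \<in> measurable ?M (count_space UNIV)"
      by (rule measurable_component_singleton)
    have 2: "(\<lambda>x. measure_pmf (K x)) \<in> measurable (count_space UNIV) ?S"
      by (rule measurable_measure_pmf)
    have "path_kernel \<mu> K n = (\<lambda>\<omega>. measure_pmf (K (\<omega> (n - 1))))"
      using False by (simp add: path_kernel_def fun_eq_iff)
    then show ?thesis
      using measurable_compose[OF 1 2] by (simp only:)
  qed
next
  fix n \<omega>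
  show "prob_space (path_kernel \<mu> K n \<omega>)"
    unfolding path_kernel_def by (rule prob_space_measure_pmf)
qed

text \<open>
  The Ionescu-Tulcea measure on infinite paths whose first point has law \<open>\<mu>\<close> and whose
  successive points are drawn from \<open>K\<close>.
\<close>

definition path_measure :: "'x pmf \<Rightarrow> ('x \<Rightarrow> 'x pmf) \<Rightarrow> (nat \<Rightarrow> 'x) measure" where
  "path_measure \<mu> K =
     projective_family.lim UNIV (Ionescu_Tulcea.CI (path_kernel \<mu> K) (\<lambda>_. count_space UNIV))
       (\<lambda>_. count_space UNIV)"


section \<open>Smooth functions\<close>

text \<open>Intended for open \<open>S\<close>: the derivatives are taken at full neighbourhoods.\<close>

fun n_times_differentiable_on ::
    "'a::real_normed_vector set \<Rightarrow> ('a \<Rightarrow> 'b::real_normed_vector) \<Rightarrow> nat \<Rightarrow> bool" where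
  "n_times_differentiable_on S f 0 \<longleftrightarrow> continuous_on S f"
| "n_times_differentiable_on S f (Suc n) \<longleftrightarrow>
     (\<forall>x\<in>S. f differentiable (at x)) \<and>
     (\<forall>v. n_times_differentiable_on S (\<lambda>x. frechet_derivative f (at x) v) n)"

definition infinitely_differentiable_on ::
    "'a::real_normed_vector set \<Rightarrow> ('a \<Rightarrow> 'b::real_normed_vector) \<Rightarrow> bool" where
  "infinitely_differentiable_on S f \<longleftrightarrow> (\<forall>n. n_times_differentiable_on S f n)"


section \<open>The game\<close>

text \<open>A state is \<open>((s\<^sup>L\<^sub>1, s\<^sup>L\<^sub>2), (s\<^bsup>F1\<^esup>, s\<^bsup>F2\<^esup>))\<close>; an action is \<open>(a\<^sup>L, a\<^bsup>F1\<^esup>, a\<^bsup>F2\<^esup>)\<close>.\<close>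

type_synonym ('l1, 'l2, 'f1, 'f2) state = "('l1 \<times> 'l2) \<times> ('f1 \<times> 'f2)"
type_synonym ('aL, 'a1, 'a2) action = "'aL \<times> 'a1 \<times> 'a2"

text \<open>
  \<open>noise_i\<close> is the stochastic matrix \<open>\<sigma>\<close> of the messages received by follower \<open>i\<close>, which are
  about the leader component that follower \<open>i\<close> does not observe.
\<close>

record ('l1, 'l2, 'f1, 'f2, 'aL, 'a1, 'a2) game =
  transition :: "('l1, 'l2, 'f1, 'f2) state \<Rightarrow> ('aL, 'a1, 'a2) action \<Rightarrow> ('l1, 'l2, 'f1, 'f2) state pmf"
  reward_L :: "('l1, 'l2, 'f1, 'f2) state \<Rightarrow> ('aL, 'a1, 'a2) action \<Rightarrow> real"
  reward_F1 :: "('l1, 'l2, 'f1, 'f2) state \<Rightarrow> ('aL, 'a1, 'a2) action \<Rightarrow> real"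
  reward_F2 :: "('l1, 'l2, 'f1, 'f2) state \<Rightarrow> ('aL, 'a1, 'a2) action \<Rightarrow> real"
  discount :: real
  noise_1 :: "'l2 \<Rightarrow> 'l2 pmf"
  noise_2 :: "'l1 \<Rightarrow> 'l1 pmf"
  memory :: nat

definition valid_game :: "('l1, 'l2, 'f1, 'f2, 'aL, 'a1, 'a2) game \<Rightarrow> bool" where
  "valid_game G \<longleftrightarrow>
     0 \<le> discount G \<and> discount G < 1 \<and> 1 \<le> memory G \<and>
     (\<forall>s. pmf (noise_1 G s) s = 0) \<and> (\<forall>s. pmf (noise_2 G s) s = 0)"

definition message_prob :: "real \<Rightarrow> ('l \<Rightarrow> 'l pmf) \<Rightarrow> 'l \<Rightarrow> 'l \<Rightarrow> real" where
  "message_prob \<epsilon> \<sigma> s z = (if z = s then 1 - \<epsilon> else \<epsilon> * pmf (\<sigma> s) z)"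

text \<open>Meaningful for \<open>0 \<le> \<epsilon> \<le> 1\<close> and \<open>\<sigma>\<close> vanishing on the diagonal.\<close>

definition message :: "real \<Rightarrow> ('l \<Rightarrow> 'l pmf) \<Rightarrow> 'l \<Rightarrow> 'l pmf" where
  "message \<epsilon> \<sigma> s = embed_pmf (message_prob \<epsilon> \<sigma> s)"


section \<open>Information histories\<close>

text \<open>
  Lists of own states at times \<open>t, \<dots>, t-\<tau>+1\<close>, of observations at the same times, and of own
  actions at times \<open>t-1, \<dots>, t-\<tau>\<close>, most recent entry first. The leader observes \<open>s\<^sup>F\<close>; follower 1
  observes \<open>(s\<^sup>L\<^sub>1, z\<^bsup>F1\<^esup>, s\<^bsup>F2\<^esup>)\<close> and follower 2 observes \<open>(s\<^sup>L\<^sub>2, z\<^bsup>F2\<^esup>, s\<^bsup>F1\<^esup>)\<close>.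
\<close>

type_synonym ('s, 'z, 'a) history = "'s list \<times> 'z list \<times> 'a list"

type_synonym ('l1, 'l2, 'f1, 'f2, 'aL) leader_history = "('l1 \<times> 'l2, 'f1 \<times> 'f2, 'aL) history"
type_synonym ('l1, 'l2, 'f1, 'f2, 'a1) follower1_history = "('f1, 'l1 \<times> 'l2 \<times> 'f2, 'a1) history"
type_synonym ('l1, 'l2, 'f1, 'f2, 'a2) follower2_history = "('f2, 'l2 \<times> 'l1 \<times> 'f1, 'a2) history"

type_synonym ('l1, 'l2, 'f1, 'f2, 'a1, 'a2) followers_history =
  "('l1, 'l2, 'f1, 'f2, 'a1) follower1_history \<times> ('l1, 'l2, 'f1, 'f2, 'a2) follower2_history"

type_synonym ('l1, 'l2, 'f1, 'f2, 'aL, 'a1, 'a2) joint_history =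
  "('l1, 'l2, 'f1, 'f2, 'aL) leader_history \<times> ('l1, 'l2, 'f1, 'f2, 'a1, 'a2) followers_history"

definition histories :: "nat \<Rightarrow> ('s, 'z, 'a) history set" where
  "histories \<tau> = {(ss, zs, as). length ss = \<tau> \<and> length zs = \<tau> \<and> length as = \<tau>}"

definition leader_histories ::
    "('l1, 'l2, 'f1, 'f2, 'aL, 'a1, 'a2) game \<Rightarrow> ('l1, 'l2, 'f1, 'f2, 'aL) leader_history set" where
  "leader_histories G = histories (memory G)"

definition followers_histories ::
    "('l1, 'l2, 'f1, 'f2, 'aL, 'a1, 'a2) game \<Rightarrow> ('l1, 'l2, 'f1, 'f2, 'a1, 'a2) followers_history set" where
  "followers_histories G = histories (memory G) \<times> histories (memory G)"

text \<open>
  The components of a joint history are not required to agree on the data they share. This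
  makes every probability distribution on \<open>followers_histories G\<close> a belief for every leader
  history; the leader's component determines the current state.
\<close>

definition joint_histories ::
    "('l1, 'l2, 'f1, 'f2, 'aL, 'a1, 'a2) game \<Rightarrow> ('l1, 'l2, 'f1, 'f2, 'aL, 'a1, 'a2) joint_history set" where
  "joint_histories G = leader_histories G \<times> followers_histories G"

definition current_state ::
    "('l1, 'l2, 'f1, 'f2, 'aL, 'a1, 'a2) joint_history \<Rightarrow> ('l1, 'l2, 'f1, 'f2) state" where
  "current_state = (\<lambda>((ss, zs, as), \<zeta>F). (hd ss, hd zs))"

definition push :: "'s \<Rightarrow> 'z \<Rightarrow> 'a \<Rightarrow> ('s, 'z, 'a) history \<Rightarrow> ('s, 'z, 'a) history" where
  "push s z a = (\<lambda>(ss, zs, as). (s # butlast ss, z # butlast zs, a # butlast as))"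

fun next_history ::
    "('l1, 'l2, 'f1, 'f2, 'aL, 'a1, 'a2) joint_history \<Rightarrow> ('aL, 'a1, 'a2) action \<Rightarrow>
     ('l1, 'l2, 'f1, 'f2) state \<Rightarrow> 'l2 \<times> 'l1 \<Rightarrow>
     ('l1, 'l2, 'f1, 'f2, 'aL, 'a1, 'a2) joint_history" where
  "next_history (\<zeta>L, \<zeta>1, \<zeta>2) (aL, a1, a2) ((l1, l2), (f1, f2)) (z1, z2) =
     (push (l1, l2) (f1, f2) aL \<zeta>L, push f1 (l1, z1, f2) a1 \<zeta>1, push f2 (l2, z2, f1) a2 \<zeta>2)"

definition next_messages ::
    "('l1, 'l2, 'f1, 'f2, 'aL, 'a1, 'a2) game \<Rightarrow> real \<Rightarrow> real \<Rightarrow>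
     ('l1, 'l2, 'f1, 'f2) state \<Rightarrow> ('l2 \<times> 'l1) pmf" where
  "next_messages G \<epsilon>1 \<epsilon>2 = (\<lambda>((l1, l2), sF).
     pair_pmf (message \<epsilon>1 (noise_1 G) l2) (message \<epsilon>2 (noise_2 G) l1))"


section \<open>Policies and the leader's value function\<close>

record ('l1, 'l2, 'f1, 'f2, 'aL, 'a1, 'a2) policies =
  policy_L :: "('l1, 'l2, 'f1, 'f2, 'aL) leader_history \<Rightarrow> 'aL pmf"
  policy_F1 :: "('l1, 'l2, 'f1, 'f2, 'a1) follower1_history \<Rightarrow> 'a1 pmf"
  policy_F2 :: "('l1, 'l2, 'f1, 'f2, 'a2) follower2_history \<Rightarrow> 'a2 pmf"

definition joint_policy ::
    "('l1, 'l2, 'f1, 'f2, 'aL, 'a1, 'a2) policies \<Rightarrow>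
     ('l1, 'l2, 'f1, 'f2, 'aL, 'a1, 'a2) joint_history \<Rightarrow> ('aL, 'a1, 'a2) action pmf" where
  "joint_policy \<delta> = (\<lambda>(\<zeta>L, \<zeta>1, \<zeta>2).
     pair_pmf (policy_L \<delta> \<zeta>L) (pair_pmf (policy_F1 \<delta> \<zeta>1) (policy_F2 \<delta> \<zeta>2)))"

text \<open>The controlled process is the Markov chain of the pairs \<open>(\<zeta>(t), a(t))\<close>.\<close>

definition act ::
    "('l1, 'l2, 'f1, 'f2, 'aL, 'a1, 'a2) policies \<Rightarrow>
     ('l1, 'l2, 'f1, 'f2, 'aL, 'a1, 'a2) joint_history \<Rightarrow>
     (('l1, 'l2, 'f1, 'f2, 'aL, 'a1, 'a2) joint_history \<times> ('aL, 'a1, 'a2) action) pmf" where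
  "act \<delta> \<zeta> = map_pmf (Pair \<zeta>) (joint_policy \<delta> \<zeta>)"

definition step ::
    "('l1, 'l2, 'f1, 'f2, 'aL, 'a1, 'a2) game \<Rightarrow> ('l1, 'l2, 'f1, 'f2, 'aL, 'a1, 'a2) policies \<Rightarrow>
     real \<Rightarrow> real \<Rightarrow>
     ('l1, 'l2, 'f1, 'f2, 'aL, 'a1, 'a2) joint_history \<times> ('aL, 'a1, 'a2) action \<Rightarrow>
     (('l1, 'l2, 'f1, 'f2, 'aL, 'a1, 'a2) joint_history \<times> ('aL, 'a1, 'a2) action) pmf" where
  "step G \<delta> \<epsilon>1 \<epsilon>2 = (\<lambda>(\<zeta>, a).
     bind_pmf (transition G (current_state \<zeta>) a) (\<lambda>s'.
     bind_pmf (next_messages G \<epsilon>1 \<epsilon>2 s') (\<lambda>z'.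
     act \<delta> (next_history \<zeta> a s' z'))))"

definition value_L ::
    "('l1, 'l2, 'f1, 'f2, 'aL, 'a1, 'a2) game \<Rightarrow> ('l1, 'l2, 'f1, 'f2, 'aL, 'a1, 'a2) policies \<Rightarrow>
     real \<Rightarrow> real \<Rightarrow> ('l1, 'l2, 'f1, 'f2, 'aL) leader_history \<Rightarrow>
     ('l1, 'l2, 'f1, 'f2, 'a1, 'a2) followers_history pmf \<Rightarrow> real" where
  "value_L G \<delta> \<epsilon>1 \<epsilon>2 \<zeta>L y =
     (\<integral>\<omega>. (\<Sum>t. discount G ^ t * reward_L G (current_state (fst (\<omega> t))) (snd (\<omega> t)))
        \<partial>path_measure (bind_pmf y (\<lambda>\<zeta>F. act \<delta> (\<zeta>L, \<zeta>F))) (step G \<delta> \<epsilon>1 \<epsilon>2))"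

definition beliefs ::
    "('l1, 'l2, 'f1, 'f2, 'aL, 'a1, 'a2) game \<Rightarrow>
     ('l1, 'l2, 'f1, 'f2, 'a1, 'a2) followers_history pmf set" where
  "beliefs G = {y. set_pmf y \<subseteq> followers_histories G}"

definition represents_value_L ::
    "('l1, 'l2, 'f1, 'f2, 'aL, 'a1, 'a2) game \<Rightarrow> ('l1, 'l2, 'f1, 'f2, 'aL, 'a1, 'a2) policies \<Rightarrow>
     real \<Rightarrow> real \<Rightarrow> (('l1, 'l2, 'f1, 'f2, 'aL, 'a1, 'a2) joint_history \<Rightarrow> real) \<Rightarrow> bool" where
  "represents_value_L G \<delta> \<epsilon>1 \<epsilon>2 g \<longleftrightarrow>
     (\<forall>\<zeta>L\<in>leader_histories G. \<forall>y\<in>beliefs G.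
        value_L G \<delta> \<epsilon>1 \<epsilon>2 \<zeta>L y = (\<Sum>\<zeta>F\<in>followers_histories G. pmf y \<zeta>F * g (\<zeta>L, \<zeta>F)))"

end

theory Submission
  imports Defs
begin

text \<open>
  The message matrices are \<open>I + \<epsilon>\<^sub>i D\<^sub>i\<close> with \<open>D\<^sub>i = \<sigma> - I\<close> of sup-norm at most 2. Hence one step of
  the chain on joint histories is \<open>T\<^sub>0\<^sub>0 + \<epsilon>\<^sub>1 T\<^sub>1\<^sub>0 + \<epsilon>\<^sub>2 T\<^sub>0\<^sub>1 + \<epsilon>\<^sub>1 \<epsilon>\<^sub>2 T\<^sub>1\<^sub>1\<close> with
  \<open>\<parallel>T\<^sub>i\<^sub>j\<parallel> \<le> 2 ^ (i + j)\<close>, so the expected reward at time \<open>t\<close> is a polynomial in \<open>(\<epsilon>\<^sub>1, \<epsilon>\<^sub>2)\<close> whose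
  coefficients are dominated by those of \<open>((1 + 2 \<epsilon>\<^sub>1) (1 + 2 \<epsilon>\<^sub>2)) ^ t\<close> times a bound on the reward.
  The discounted sum over \<open>t\<close> can therefore be rearranged into a power series as soon as
  \<open>\<beta> (1 + 2 \<epsilon>\<^sub>1) (1 + 2 \<epsilon>\<^sub>2) < 1\<close>, which the stated ranges guarantee; they are open squares, on which
  power series can be differentiated termwise.
\<close>

section \<open>Marginals of path measures\<close>

text \<open>The event that coordinate \<open>n\<close> lies in \<open>A\<close> is a cylinder, so
  its measure is computed by the finite stage \<open>IT.C 0 (Suc n)\<close>, where integrating out
  the last kernel lowers the time by one. Marginals at a single time suffice for the value function,
  since each reward depends on one coordinate of the path.\<close>

lemma distr_path_measure:
  "distr (path_measure \<mu> K) (count_space UNIV) (\<lambda>\<omega>. \<omega> n) =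
     measure_pmf (((\<lambda>\<nu>. bind_pmf \<nu> K) ^^ n) \<mu>)"
proof -
  let ?M = "\<lambda>_::nat. count_space (UNIV :: 'a set)"
  interpret IT: Ionescu_Tulcea "path_kernel \<mu> K" ?M
    by (rule Ionescu_Tulcea_path_kernel)
  \<comment> \<open>The integrand is arbitrary because the induction hypothesis is applied to the
    average of \<open>f\<close> under \<open>K\<close>. Stage \<open>Suc n\<close> carries the
    coordinates \<open>0\<close> to \<open>n\<close>.\<close>
  have C: "(\<integral>\<^sup>+\<omega>. f (\<omega> n) \<partial>IT.C 0 (Suc n) (\<lambda>_. undefined)) =
      (\<integral>\<^sup>+x. f x \<partial>measure_pmf (((\<lambda>\<nu>. bind_pmf \<nu> K) ^^ n) \<mu>))" for f :: "'a \<Rightarrow> ennreal"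
  proof (induction n arbitrary: f)
    case 0
    have "(\<integral>\<^sup>+\<omega>. f (\<omega> 0) \<partial>IT.eP 0 (\<lambda>_. undefined)) = (\<integral>\<^sup>+x. f x \<partial>measure_pmf \<mu>)"
      by (subst IT.nn_integral_eP)
         (auto simp: path_kernel_def space_PiM intro!: measurable_compose[OF measurable_component_singleton])
    then show ?case
      using bind_return[OF IT.measurable_eP[of 0], of "\<lambda>_. undefined"] by (simp add: space_PiM)
  next
    case (Suc n)
    have "(\<integral>\<^sup>+\<omega>. f (\<omega> (Suc n)) \<partial>IT.C 0 (Suc (Suc n)) (\<lambda>_. undefined)) =
        (\<integral>\<^sup>+\<omega>. (\<integral>\<^sup>+\<omega>'. f (\<omega>' (Suc n)) \<partial>IT.eP (Suc n) \<omega>) \<partial>IT.C 0 (Suc n) (\<lambda>_. undefined))"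
      unfolding IT.C.simps(2)[of 0 "Suc n"] add_0
      by (rule nn_integral_bind[where B="PiM {0..<Suc (Suc n)} ?M"])
         (auto intro!: measurable_compose[OF measurable_component_singleton] 
            simp: measurable_cong_sets[OF IT.sets_C] space_PiM IT.measurable_eP simp del: IT.C.simps)
    also have "\<dots> = (\<integral>\<^sup>+\<omega>. (\<integral>\<^sup>+x. f x \<partial>K (\<omega> n)) \<partial>IT.C 0 (Suc n) (\<lambda>_. undefined))"
    proof (rule nn_integral_cong)
      fix \<omega> assume "\<omega> \<in> space (IT.C 0 (Suc n) (\<lambda>_. undefined))"
      then have "\<omega> \<in> space (PiM {0..<Suc n} ?M)"
        by (subst (asm) IT.space_C) (auto simp: space_PiM)
      then show "(\<integral>\<^sup>+\<omega>'. f (\<omega>' (Suc n)) \<partial>IT.eP (Suc n) \<omega>) = (\<integral>\<^sup>+x. f x \<partial>K (\<omega> n))"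
        by (subst IT.nn_integral_eP) 
          (auto simp: path_kernel_def intro!: measurable_compose[OF measurable_component_singleton])
    qed
    also have "\<dots> = (\<integral>\<^sup>+x. (\<integral>\<^sup>+y. f y \<partial>K x) \<partial>measure_pmf (((\<lambda>\<nu>. bind_pmf \<nu> K) ^^ n) \<mu>))"
      by (rule Suc.IH)
    finally show ?case by simp
  qed
  show ?thesis
  proof (rule measure_eqI)
    fix A :: "'a set"
    have m: "(\<lambda>\<omega>. \<omega> n) \<in> measurable (path_measure \<mu> K) (count_space UNIV)"
      unfolding path_measure_def measurable_cong_sets[OF IT.PF.sets_lim refl]
      by (rule measurable_component_singleton) simp
    let ?X = "PiE {n} (\<lambda>_. A)"
    have X: "?X \<in> sets (PiM {n} ?M)" by (rule sets_PiM_I_finite) auto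
    have "emeasure (distr (path_measure \<mu> K) (count_space UNIV) (\<lambda>\<omega>. \<omega> n)) A =
        emeasure (path_measure \<mu> K) (IT.PF.emb UNIV {n} ?X)"
      by (subst emeasure_distr[OF m])
         (auto simp: path_measure_def space_PiM prod_emb_def PiE_iff intro!: arg_cong2[where f=emeasure])
    also have "\<dots> = emeasure (IT.C 0 (Suc n) (\<lambda>_. undefined)) (IT.PF.emb {0..<Suc n} {n} ?X)"
      unfolding path_measure_def using X
      by (subst IT.lim) (auto intro!: IT.emeasure_CI simp del: IT.C.simps)
    also have "\<dots> = (\<integral>\<^sup>+\<omega>. indicator A (\<omega> n) \<partial>IT.C 0 (Suc n) (\<lambda>_. undefined))"
      using X
      by (subst nn_integral_indicator[symmetric])
         (auto intro!: nn_integral_cong split: split_indicator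
            simp: IT.space_C IT.sets_C space_PiM prod_emb_def PiE_iff simp del: IT.C.simps nn_integral_indicator)
    also have "\<dots> = emeasure (measure_pmf (((\<lambda>\<nu>. bind_pmf \<nu> K) ^^ n) \<mu>)) A"
      by (simp add: C del: IT.C.simps)
    finally show "emeasure (distr (path_measure \<mu> K) (count_space UNIV) (\<lambda>\<omega>. \<omega> n)) A =
        emeasure (measure_pmf (((\<lambda>\<nu>. bind_pmf \<nu> K) ^^ n) \<mu>)) A" .
  qed simp
qed

lemma measurable_path_measure:
  "(\<lambda>\<omega>. f (\<omega> n)) \<in> measurable (path_measure \<mu> K) N" if "range f \<subseteq> space N"
proof -
  interpret IT: Ionescu_Tulcea "path_kernel \<mu> K" "\<lambda>_. count_space UNIV"
    by (rule Ionescu_Tulcea_path_kernel)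
  show ?thesis
    unfolding path_measure_def measurable_cong_sets[OF IT.PF.sets_lim refl]
    by (rule measurable_compose[OF measurable_component_singleton]) (use that in auto)
qed

text \<open>A measure has the same total mass as its image, and the image under coordinate
  \<open>0\<close> is a pmf.\<close>

lemma prob_space_path_measure: "prob_space (path_measure \<mu> K)"
  by (rule prob_space_distrD[where f="\<lambda>\<omega>. \<omega> 0" and N="count_space UNIV"])
     (auto simp: distr_path_measure prob_space_measure_pmf intro: measurable_path_measure[where f="\<lambda>x. x"])

lemma integral_path_measure:
  fixes f :: "'a \<Rightarrow> real"
  shows "(\<integral>\<omega>. f (\<omega> n) \<partial>path_measure \<mu> K) = (\<integral>x. f x \<partial>measure_pmf (((\<lambda>\<nu>. bind_pmf \<nu> K) ^^ n) \<mu>))"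
  by (subst distr_path_measure[symmetric], subst integral_distr)
     (auto intro: measurable_path_measure[where f="\<lambda>x. x"])

lemma integral_bind_pmf_bounded:
  fixes f :: "'b \<Rightarrow> real"
  assumes "\<And>x. \<bar>f x\<bar> \<le> B"
  shows "(\<integral>x. f x \<partial>bind_pmf p K) = (\<integral>x. (\<integral>y. f y \<partial>K x) \<partial>p)"
  unfolding measure_pmf_bind
  by (rule integral_bind[where B=B and B'=1 and K="count_space UNIV"])
     (use assms in \<open>auto simp: measure_pmf.finite_measure_axioms
        measure_pmf.emeasure_space_1 measure_pmf_in_subprob_algebra\<close>)


section \<open>Double power series on a square\<close>

text \<open>Since \<open>S\<close> is open, derivatives at its points depend only on values in
  \<open>S\<close>. This later transfers smoothness from a power sum to the value function, which is
  shown to agree with it on the square only.\<close>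

lemma n_times_differentiable_on_cong:
  assumes "open S" "\<And>x. x \<in> S \<Longrightarrow> f x = g x"
  shows "n_times_differentiable_on S f n \<longleftrightarrow> n_times_differentiable_on S g n"
  using assms(2)
proof (induction n arbitrary: f g)
  case 0
  then show ?case by (simp cong: continuous_on_cong)
next
  case (Suc n)
  have der: "(f has_derivative D) (at x) \<longleftrightarrow> (g has_derivative D) (at x)" if "x \<in> S" for x D
    using has_derivative_transform_within_open[OF _ \<open>open S\<close> that] Suc.prems by metis
  have "f differentiable (at x) \<longleftrightarrow> g differentiable (at x)" if "x \<in> S" for x
    using der[OF that] by (simp add: differentiable_def)
  moreover have "frechet_derivative f (at x) = frechet_derivative g (at x)" if "x \<in> S" for x
    using der[OF that] by (simp add: frechet_derivative_def)
  then have "n_times_differentiable_on S (\<lambda>x. frechet_derivative f (at x) v) n \<longleftrightarrow>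
      n_times_differentiable_on S (\<lambda>x. frechet_derivative g (at x) v) n" for v
    by (intro Suc.IH) simp
  ultimately show ?case by simp
qed

section \<open>Double power series and their formal partial derivatives\<close>

abbreviation power_terms :: "(nat \<times> nat \<Rightarrow> real) \<Rightarrow> real \<times> real \<Rightarrow> nat \<times> nat \<Rightarrow> real" where
  "power_terms a z \<equiv> \<lambda>kl. a kl * (fst z ^ fst kl * snd z ^ snd kl)"

text \<open>Summability over index pairs is unconditional, hence absolute for reals. On the positive
  square all monomials are positive and monotone in each coordinate, so terms can be compared with
  those at a larger point.\<close>

definition convergent_on_square :: "real \<Rightarrow> (nat \<times> nat \<Rightarrow> real) \<Rightarrow> bool" where
  "convergent_on_square \<rho> a \<longleftrightarrow> (\<forall>z\<in>{0<..<\<rho>} \<times> {0<..<\<rho>}. power_terms a z summable_on UNIV)"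

definition power_sum :: "(nat \<times> nat \<Rightarrow> real) \<Rightarrow> real \<times> real \<Rightarrow> real" where
  "power_sum a z = infsum (power_terms a z) UNIV"

text \<open>Formal partial derivative in the first variable, re-indexed to be a coefficient family
  of the same kind.\<close>

definition coeff_dx :: "(nat \<times> nat \<Rightarrow> real) \<Rightarrow> nat \<times> nat \<Rightarrow> real" where
  "coeff_dx a = (\<lambda>(k, l). real (Suc k) * a (Suc k, l))"

definition coeff_dy :: "(nat \<times> nat \<Rightarrow> real) \<Rightarrow> nat \<times> nat \<Rightarrow> real" where
  "coeff_dy a = (\<lambda>(k, l). real (Suc l) * a (k, Suc l))"

text \<open>Differentiation in the first variable annihilates the terms of first exponent
  \<open>0\<close>; dropping them turns the termwise derivative into the power series of
  \<open>coeff_dx\<close>.\<close>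

lemma has_sum_shift_fst:
  fixes f :: "nat \<times> nat \<Rightarrow> 'b::{comm_monoid_add, topological_space}"
  assumes "\<And>l. f (0, l) = 0"
  shows "(f has_sum s) UNIV \<longleftrightarrow> ((\<lambda>(k, l). f (Suc k, l)) has_sum s) UNIV"
proof -
  have "((\<lambda>(k, l). f (Suc k, l)) has_sum s) UNIV \<longleftrightarrow> (f has_sum s) (range (\<lambda>(k, l). (Suc k, l)))"
    by (subst has_sum_reindex) (auto simp: inj_on_def o_def case_prod_unfold)
  also have "\<dots> \<longleftrightarrow> (f has_sum s) UNIV"
  proof (rule has_sum_cong_neutral)
    fix kl assume "kl \<in> UNIV - range (\<lambda>(k::nat, l::nat). (Suc k, l))"
    then show "f kl = 0"
      using assms by (cases kl; cases "fst kl") (auto simp: image_iff)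
  qed auto
  finally show ?thesis by simp
qed

lemma has_sum_shift_snd:
  fixes f :: "nat \<times> nat \<Rightarrow> 'b::{comm_monoid_add, topological_space}"
  assumes "\<And>k. f (k, 0) = 0"
  shows "(f has_sum s) UNIV \<longleftrightarrow> ((\<lambda>(k, l). f (k, Suc l)) has_sum s) UNIV"
proof -
  have "((\<lambda>(k, l). f (k, Suc l)) has_sum s) UNIV \<longleftrightarrow> (f has_sum s) (range (\<lambda>(k, l). (k, Suc l)))"
    by (subst has_sum_reindex) (auto simp: inj_on_def o_def case_prod_unfold)
  also have "\<dots> \<longleftrightarrow> (f has_sum s) UNIV"
  proof (rule has_sum_cong_neutral)
    fix kl assume "kl \<in> UNIV - range (\<lambda>(k::nat, l::nat). (k, Suc l))"
    then show "f kl = 0"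
      using assms by (cases kl; cases "snd kl") (auto simp: image_iff)
  qed auto
  finally show ?thesis by simp
qed


text \<open>The factor gained by differentiation is absorbed by moving \<open>x\<close> outwards to
  some \<open>r\<close> below \<rho>: \<open>k * (x / r) ^ k\<close> is bounded, so the new terms at
  \<open>(x, y)\<close> are dominated by a constant multiple of the old terms at
  \<open>(r, y)\<close>.\<close>

lemma convergent_on_square_coeff_dx:
  assumes "convergent_on_square \<rho> a"
  shows "convergent_on_square \<rho> (coeff_dx a)"
  unfolding convergent_on_square_def
proof
  fix z assume "z \<in> {0<..<\<rho>} \<times> {0<..<\<rho>}"
  then obtain x y where z: "z = (x, y)" "0 < x" "x < \<rho>" "0 < y" "y < \<rho>" by auto
  define r where "r = (x + \<rho>) / 2"
  have r: "x < r" "r < \<rho>" "0 < r" using z by (auto simp: r_def)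
  have "norm (x / r) < 1" using r z by simp
  then have "(\<lambda>k. real k * (x / r) ^ k) \<longlonglongrightarrow> 0"
    by (rule powser_times_n_limit_0)
  then have "Bseq (\<lambda>k. real k * (x / r) ^ k)"
    by (intro convergent_imp_Bseq convergentI)
  then obtain B where B: "\<And>k. norm (real k * (x / r) ^ k) \<le> B"
    unfolding Bseq_def by blast
  have "power_terms a (r, y) summable_on UNIV"
    using assms r z by (auto simp: convergent_on_square_def)
  then have "(\<lambda>kl. norm (power_terms a (r, y) kl)) summable_on UNIV"
    by (rule summable_on_iff_abs_summable_on_real[THEN iffD1])
  then have "(\<lambda>kl. norm (power_terms a (r, y) kl)) summable_on range (\<lambda>(k, l). (Suc k, l))"
    by (rule summable_on_subset_banach) simp
  then have "(\<lambda>kl. norm (power_terms a (r, y) (Suc (fst kl), snd kl))) summable_on UNIV"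
    by (subst (asm) summable_on_reindex) (auto simp: inj_on_def o_def case_prod_unfold)
  then have "(\<lambda>kl. B / x * norm (power_terms a (r, y) (Suc (fst kl), snd kl))) summable_on UNIV"
    by (rule summable_on_cmult_right)
  then have "(\<lambda>kl. norm (power_terms (coeff_dx a) z kl)) summable_on UNIV"
  proof (rule summable_on_comparison_test)
    fix kl :: "nat \<times> nat"
    obtain k l where kl: "kl = (k, l)" by (cases kl)
    \<comment> \<open>This isolates the bounded factor with index \<open>Suc k\<close>; the leftover
      \<open>1 / x\<close> goes into the constant \<open>B / x\<close>.\<close>
    have "real (Suc k) * x ^ k = (real (Suc k) * (x / r) ^ Suc k) * (r ^ Suc k / x)"
      using r(3) z(2) by (simp add: power_divide del: of_nat_Suc)
    also have "\<dots> \<le> B * (r ^ Suc k / x)"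
      using B[of "Suc k"] r(3) z(2) by (intro mult_right_mono) (auto simp del: of_nat_Suc power_Suc)
    finally have *: "real (Suc k) * x ^ k * (\<bar>a (Suc k, l)\<bar> * y ^ l) \<le> B * (r ^ Suc k / x) * (\<bar>a (Suc k, l)\<bar> * y ^ l)"
      using z(4) by (intro mult_right_mono) auto
    have "norm (power_terms (coeff_dx a) z kl) = real (Suc k) * x ^ k * (\<bar>a (Suc k, l)\<bar> * y ^ l)"
      using z(2,4) by (simp add: z(1) kl coeff_dx_def abs_mult mult_ac del: of_nat_Suc)
    also note *
    also have "B * (r ^ Suc k / x) * (\<bar>a (Suc k, l)\<bar> * y ^ l) =
        B / x * norm (power_terms a (r, y) (Suc (fst kl), snd kl))"
      using r(3) z(4) by (simp add: kl abs_mult del: power_Suc)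
    finally show "norm (power_terms (coeff_dx a) z kl) \<le>
        B / x * norm (power_terms a (r, y) (Suc (fst kl), snd kl))" .
  qed (rule norm_ge_zero)
  then show "power_terms (coeff_dx a) z summable_on UNIV"
    by (rule summable_on_iff_abs_summable_on_real[THEN iffD2])
qed

lemma has_sum_swap_UNIV:
  "(f has_sum s) UNIV \<longleftrightarrow> ((f \<circ> prod.swap) has_sum s) (UNIV :: (nat \<times> nat) set)"
  using has_sum_reindex[of prod.swap UNIV f s] by (simp add: surj_swap)

lemma summable_swap_UNIV:
  "f summable_on UNIV \<longleftrightarrow> (f \<circ> prod.swap) summable_on (UNIV :: (nat \<times> nat) set)"
  using has_sum_swap_UNIV[of f] by (simp add: summable_on_def)

lemma power_terms_swap: "power_terms (a \<circ> prod.swap) z = power_terms a (prod.swap z) \<circ> prod.swap"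
  by (auto simp: fun_eq_iff)

lemma convergent_on_square_swap:
  "convergent_on_square \<rho> a \<Longrightarrow> convergent_on_square \<rho> (a \<circ> prod.swap)"
  unfolding convergent_on_square_def power_terms_swap summable_swap_UNIV[symmetric] by auto

text \<open>Exchanging the coordinates reduces the convergence of \<open>coeff_dy\<close> to that of
  \<open>coeff_dx\<close>, as the square is symmetric.\<close>

lemma coeff_dy_swap: "coeff_dy a = coeff_dx (a \<circ> prod.swap) \<circ> prod.swap"
  by (auto simp: fun_eq_iff coeff_dx_def coeff_dy_def)

lemma convergent_on_square_coeff_dy:
  "convergent_on_square \<rho> a \<Longrightarrow> convergent_on_square \<rho> (coeff_dy a)"
  unfolding coeff_dy_swap
  by (intro convergent_on_square_swap convergent_on_square_coeff_dx)

text \<open>A directional derivative is a linear combination of the two partial ones; closure under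
  such combinations keeps the induction on the order of differentiation inside one class of
  series.\<close>

lemma convergent_on_square_lincomb:
  assumes "convergent_on_square \<rho> a" "convergent_on_square \<rho> b"
  shows "convergent_on_square \<rho> (\<lambda>kl. u * a kl + v * b kl)"
  using assms unfolding convergent_on_square_def
  by (auto simp: distrib_right mult.assoc intro!: summable_on_add summable_on_cmult_right)

lemma power_sum_lincomb:
  assumes "convergent_on_square \<rho> a" "convergent_on_square \<rho> b" "z \<in> {0<..<\<rho>} \<times> {0<..<\<rho>}"
  shows "power_sum (\<lambda>kl. u * a kl + v * b kl) z = u * power_sum a z + v * power_sum b z"
proof -
  have "power_terms a z summable_on UNIV" "power_terms b z summable_on UNIV"
    using assms by (auto simp: convergent_on_square_def)
  then show ?thesis
    unfolding power_sum_def
    by (simp add: distrib_right mult.assoc infsum_add infsum_cmult_right summable_on_cmult_right)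
qed

section \<open>Termwise differentiation\<close>

lemma power_sum_has_sum:
  assumes "convergent_on_square \<rho> a" "z \<in> {0<..<\<rho>} \<times> {0<..<\<rho>}"
  shows "(power_terms a z has_sum power_sum a z) UNIV"
  using assms by (auto simp: convergent_on_square_def power_sum_def)

text \<open>The truncated exponent \<open>fst kl - 1\<close> is harmless at
  \<open>fst kl = 0\<close>, where the factor \<open>real (fst kl)\<close> vanishes; the other terms
  are a shift of those of \<open>coeff_dx\<close>.\<close>

lemma has_sum_terms_dx:
  assumes "convergent_on_square \<rho> a" "z \<in> {0<..<\<rho>} \<times> {0<..<\<rho>}"
  shows "((\<lambda>kl. a kl * (real (fst kl) * fst z ^ (fst kl - 1) * snd z ^ snd kl)) has_sum power_sum (coeff_dx a) z) UNIV"
  using power_sum_has_sum[OF convergent_on_square_coeff_dx[OF assms(1)] assms(2)]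
  by (subst has_sum_shift_fst)
     (auto simp: coeff_dx_def case_prod_unfold mult_ac simp del: of_nat_Suc)

lemma has_sum_terms_dy:
  assumes "convergent_on_square \<rho> a" "z \<in> {0<..<\<rho>} \<times> {0<..<\<rho>}"
  shows "((\<lambda>kl. a kl * (fst z ^ fst kl * (real (snd kl) * snd z ^ (snd kl - 1)))) has_sum power_sum (coeff_dy a) z) UNIV"
  using power_sum_has_sum[OF convergent_on_square_coeff_dy[OF assms(1)] assms(2)]
  by (subst has_sum_shift_snd)
     (auto simp: coeff_dy_def case_prod_unfold mult_ac simp del: of_nat_Suc)

text \<open>Enumerating the index pairs turns an unordered sum into a sequential series, the form
  that the Weierstrass M-test and \<open>has_derivative_series\<close> take.\<close>

lemma has_sum_imp_sums_prod_decode: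
  fixes f :: "nat \<times> nat \<Rightarrow> real"
  assumes "(f has_sum s) UNIV"
  shows "(\<lambda>n. f (prod_decode n)) sums s"
  using assms by (intro has_sum_imp_sums) (simp add: has_sum_reindex_bij_betw[OF bij_prod_decode])

text \<open>Weierstrass M-test, with the absolute values of the terms at the single point
  \<open>z0\<close> as majorants. In the application \<open>z0\<close> is the upper corner of an
  open square \<open>A\<close>.\<close>

lemma uniform_limit_prod_decode:
  fixes f :: "nat \<times> nat \<Rightarrow> 'a \<Rightarrow> real"
  assumes "\<And>z. z \<in> A \<Longrightarrow> ((\<lambda>kl. f kl z) has_sum F z) UNIV"
    and "((\<lambda>kl. f kl z0) has_sum s0) UNIV"
    and "\<And>kl z. z \<in> A \<Longrightarrow> \<bar>f kl z\<bar> \<le> \<bar>f kl z0\<bar>"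
  shows "uniform_limit A (\<lambda>n z. \<Sum>i<n. f (prod_decode i) z) F sequentially"
proof -
  have "(\<lambda>kl. norm (f kl z0)) summable_on UNIV"
    by (rule summable_on_iff_abs_summable_on_real[THEN iffD1, OF has_sum_imp_summable[OF assms(2)]])
  then obtain M where M: "((\<lambda>kl. norm (f kl z0)) has_sum M) UNIV" unfolding summable_on_def by blast
  have "summable (\<lambda>n. norm (f (prod_decode n) z0))"
    using sums_summable[OF has_sum_imp_sums_prod_decode[OF M]] by simp
  then have "uniform_limit A (\<lambda>n z. \<Sum>i<n. f (prod_decode i) z) (\<lambda>z. \<Sum>i. f (prod_decode i) z) sequentially"
    by (rule Weierstrass_m_test[rotated]) (simp add: assms(3))
  moreover have "(\<Sum>i. f (prod_decode i) z) = F z" if "z \<in> A" for z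
    using has_sum_imp_sums_prod_decode[OF assms(1)[OF that]] by (simp add: sums_iff)
  ultimately show ?thesis
    by (subst uniform_limit_cong'[where h="\<lambda>z. \<Sum>i. f (prod_decode i) z", symmetric]) auto
qed

text \<open>Both series of partial derivatives converge uniformly on a smaller square, because their
  terms are dominated by those at its upper corner, which is still a point of convergence. Uniform
  convergence of the derivatives permits termwise differentiation.\<close>

lemma power_sum_has_derivative:
  assumes a: "convergent_on_square \<rho> a" and z: "z \<in> {0<..<\<rho>} \<times> {0<..<\<rho>}"
  shows "(power_sum a has_derivative
           (\<lambda>h. fst h * power_sum (coeff_dx a) z + snd h * power_sum (coeff_dy a) z)) (at z)"
proof -
  \<comment> \<open>Midway between the larger coordinate of \<open>z\<close> and \<rho>:
    \<open>z\<close> lies in the open square \<open>A\<close>, and the corner \<open>(r, r)\<close>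
    lies in the square of convergence.\<close>
  define r where "r = (max (fst z) (snd z) + \<rho>) / 2"
  define A where "A = {0<..<r} \<times> {0<..<r}"
  have zA: "z \<in> A" and r: "(r, r) \<in> {0<..<\<rho>} \<times> {0<..<\<rho>}" and A: "A \<subseteq> {0<..<\<rho>} \<times> {0<..<\<rho>}"
    using z by (auto simp: A_def r_def)
  have oA: "open A" unfolding A_def by (intro open_Times) auto
  define dx where "dx = (\<lambda>kl (w :: real \<times> real). a kl * (real (fst kl) * fst w ^ (fst kl - 1) * snd w ^ snd kl))"
  define dy where "dy = (\<lambda>kl (w :: real \<times> real). a kl * (fst w ^ fst kl * (real (snd kl) * snd w ^ (snd kl - 1))))"
  have box: "0 \<le> fst w" "fst w \<le> r" "0 \<le> snd w" "snd w \<le> r" if "w \<in> A" for w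
    using that by (auto simp: A_def)
  have "0 \<le> r" using r by simp
  have ux: "uniform_limit A (\<lambda>n w. \<Sum>i<n. dx (prod_decode i) w) (power_sum (coeff_dx a)) sequentially"
  proof (rule uniform_limit_prod_decode)
    show "((\<lambda>kl. dx kl w) has_sum power_sum (coeff_dx a) w) UNIV" if "w \<in> A" for w
      unfolding dx_def by (rule has_sum_terms_dx[OF a subsetD[OF A that]])
    show "((\<lambda>kl. dx kl (r, r)) has_sum power_sum (coeff_dx a) (r, r)) UNIV"
      unfolding dx_def by (rule has_sum_terms_dx[OF a r])
    show "\<bar>dx kl w\<bar> \<le> \<bar>dx kl (r, r)\<bar>" if "w \<in> A" for kl w
      unfolding dx_def abs_mult power_abs fst_conv snd_conv
      using box[OF that] \<open>0 \<le> r\<close> by (intro mult_mono power_mono mult_nonneg_nonneg) auto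
  qed
  have uy: "uniform_limit A (\<lambda>n w. \<Sum>i<n. dy (prod_decode i) w) (power_sum (coeff_dy a)) sequentially"
  proof (rule uniform_limit_prod_decode)
    show "((\<lambda>kl. dy kl w) has_sum power_sum (coeff_dy a) w) UNIV" if "w \<in> A" for w
      unfolding dy_def by (rule has_sum_terms_dy[OF a subsetD[OF A that]])
    show "((\<lambda>kl. dy kl (r, r)) has_sum power_sum (coeff_dy a) (r, r)) UNIV"
      unfolding dy_def by (rule has_sum_terms_dy[OF a r])
    show "\<bar>dy kl w\<bar> \<le> \<bar>dy kl (r, r)\<bar>" if "w \<in> A" for kl w
      unfolding dy_def abs_mult power_abs fst_conv snd_conv
      using box[OF that] \<open>0 \<le> r\<close> by (intro mult_mono power_mono mult_nonneg_nonneg) auto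
  qed
  have "\<exists>g. \<forall>w\<in>A. (\<lambda>n. power_terms a w (prod_decode n)) sums g w \<and>
      (g has_derivative (\<lambda>h. fst h * power_sum (coeff_dx a) w + snd h * power_sum (coeff_dy a) w)) (at w within A)"
  proof (rule has_derivative_series[where
        f'="\<lambda>n w h. fst h * dx (prod_decode n) w + snd h * dy (prod_decode n) w"])
    show "convex A" unfolding A_def by (intro convex_Times) auto
    show "((\<lambda>w. power_terms a w (prod_decode n)) has_derivative
        (\<lambda>h. fst h * dx (prod_decode n) w + snd h * dy (prod_decode n) w)) (at w within A)" for n w
      unfolding dx_def dy_def
      by (auto intro!: derivative_eq_intros simp: algebra_simps)
    show "z \<in> A" by fact
    show "(\<lambda>n. power_terms a z (prod_decode n)) sums power_sum a z"
      using has_sum_imp_sums_prod_decode[OF power_sum_has_sum[OF a z]] by simp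
    fix e :: real assume e: "e > 0"
    \<comment> \<open>Each coordinate direction receives \<open>e / 2\<close>, since both
      coordinates of \<open>h\<close> are at most \<open>norm h\<close> in absolute value.\<close>
    have "\<forall>\<^sub>F n in sequentially. \<forall>w\<in>A. \<bar>(\<Sum>i<n. dx (prod_decode i) w) - power_sum (coeff_dx a) w\<bar> < e / 2"
      using ux[unfolded uniform_limit_iff dist_real_def, rule_format, of "e / 2"] e by simp
    moreover have "\<forall>\<^sub>F n in sequentially. \<forall>w\<in>A. \<bar>(\<Sum>i<n. dy (prod_decode i) w) - power_sum (coeff_dy a) w\<bar> < e / 2"
      using uy[unfolded uniform_limit_iff dist_real_def, rule_format, of "e / 2"] e by simp
    ultimately show "\<forall>\<^sub>F n in sequentially. \<forall>w\<in>A. \<forall>h.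
        norm ((\<Sum>i<n. fst h * dx (prod_decode i) w + snd h * dy (prod_decode i) w) -
          (fst h * power_sum (coeff_dx a) w + snd h * power_sum (coeff_dy a) w)) \<le> e * norm h"
    proof eventually_elim
      case (elim n)
      show ?case
      proof (intro ballI allI)
        fix w and h :: "real \<times> real" assume w: "w \<in> A"
        let ?X = "(\<Sum>i<n. dx (prod_decode i) w) - power_sum (coeff_dx a) w"
        let ?Y = "(\<Sum>i<n. dy (prod_decode i) w) - power_sum (coeff_dy a) w"
        have "(\<Sum>i<n. fst h * dx (prod_decode i) w + snd h * dy (prod_decode i) w) -
          (fst h * power_sum (coeff_dx a) w + snd h * power_sum (coeff_dy a) w) = fst h * ?X + snd h * ?Y"
          by (simp add: sum.distrib sum_distrib_left algebra_simps)
        also have "norm \<dots> \<le> \<bar>fst h\<bar> * \<bar>?X\<bar> + \<bar>snd h\<bar> * \<bar>?Y\<bar>"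
          using abs_triangle_ineq[of "fst h * ?X" "snd h * ?Y"] by (simp add: abs_mult)
        also have "\<dots> \<le> norm h * (e / 2) + norm h * (e / 2)"
          using elim w norm_fst_le[of "fst h" "snd h"] norm_snd_le[of "snd h" "fst h"]
          by (intro add_mono mult_mono) (auto intro: less_imp_le)
        finally show "norm ((\<Sum>i<n. fst h * dx (prod_decode i) w + snd h * dy (prod_decode i) w) -
          (fst h * power_sum (coeff_dx a) w + snd h * power_sum (coeff_dy a) w)) \<le> e * norm h"
          by (simp add: mult.commute)
      qed
    qed
  qed
  then obtain g where g: "\<And>w. w \<in> A \<Longrightarrow> (\<lambda>n. power_terms a w (prod_decode n)) sums g w"
    and dg: "(g has_derivative
      (\<lambda>h. fst h * power_sum (coeff_dx a) z + snd h * power_sum (coeff_dy a) z)) (at z within A)"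
    using zA by blast
  have [simp]: "g w = power_sum a w" if "w \<in> A" for w
  proof (rule sums_unique2[OF g[OF that]])
    have "w \<in> {0<..<\<rho>} \<times> {0<..<\<rho>}" using that A by blast
    then show "(\<lambda>n. power_terms a w (prod_decode n)) sums power_sum a w"
      using has_sum_imp_sums_prod_decode[OF power_sum_has_sum[OF a]] by simp
  qed
  show ?thesis
    using dg unfolding at_within_open[OF zA oA]
    by (rule has_derivative_transform_within_open[OF _ oA zA]) simp
qed

text \<open>Every directional derivative is again a power sum convergent on the same square, so the
  induction on the order runs over all coefficient families at once.\<close>

lemma power_sum_infinitely_differentiable:
  assumes "convergent_on_square \<rho> a"
  shows "infinitely_differentiable_on ({0<..<\<rho>} \<times> {0<..<\<rho>}) (power_sum a)"
proof -
  have "n_times_differentiable_on ({0<..<\<rho>} \<times> {0<..<\<rho>}) (power_sum a) n" for n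
    using assms
  proof (induction n arbitrary: a)
    case 0
    have "continuous_on ({0<..<\<rho>} \<times> {0<..<\<rho>}) (power_sum a)"
      by (rule continuous_at_imp_continuous_on)
         (use has_derivative_continuous[OF power_sum_has_derivative[OF 0]] in blast)
    then show ?case by simp
  next
    case (Suc n)
    have "n_times_differentiable_on ({0<..<\<rho>} \<times> {0<..<\<rho>}) (\<lambda>z. frechet_derivative (power_sum a) (at z) v) n"
      for v
    proof (subst n_times_differentiable_on_cong)
      show "open ({0<..<\<rho>} \<times> {0<..<\<rho>})" by (intro open_Times) auto
      show "frechet_derivative (power_sum a) (at z) v =
          power_sum (\<lambda>kl. fst v * coeff_dx a kl + snd v * coeff_dy a kl) z"
        if "z \<in> {0<..<\<rho>} \<times> {0<..<\<rho>}" for z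
        using frechet_derivative_at[OF power_sum_has_derivative[OF Suc.prems that], symmetric]
          power_sum_lincomb[OF convergent_on_square_coeff_dx[OF Suc.prems]
            convergent_on_square_coeff_dy[OF Suc.prems] that]
        by simp
      show "n_times_differentiable_on ({0<..<\<rho>} \<times> {0<..<\<rho>})
          (power_sum (\<lambda>kl. fst v * coeff_dx a kl + snd v * coeff_dy a kl)) n"
        by (intro Suc.IH convergent_on_square_lincomb convergent_on_square_coeff_dx
            convergent_on_square_coeff_dy Suc.prems)
    qed
    moreover have "\<forall>z\<in>{0<..<\<rho>} \<times> {0<..<\<rho>}. power_sum a differentiable (at z)"
      using power_sum_has_derivative[OF Suc.prems] unfolding differentiable_def by blast
    ultimately show ?case by simp
  qed
  then show ?thesis by (simp add: infinitely_differentiable_on_def)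
qed


section \<open>Discounted rewards of perturbed chains\<close>

text \<open>Multiplication of a power series by the monomial \<open>x ^ i * y ^ j\<close>, seen on
  coefficients.\<close>

definition shift_coeffs :: "nat \<Rightarrow> nat \<Rightarrow> (nat \<times> nat \<Rightarrow> real) \<Rightarrow> nat \<times> nat \<Rightarrow> real" where
  "shift_coeffs i j c = (\<lambda>(k, l). if i \<le> k \<and> j \<le> l then c (k - i, l - j) else 0)"

lemma has_sum_shift_coeffs:
  assumes "(power_terms c z has_sum s) UNIV"
  shows "(power_terms (shift_coeffs i j c) z has_sum fst z ^ i * snd z ^ j * s) UNIV"
proof -
  let ?h = "\<lambda>(k, l). (k + i, l + j)"
  have "((\<lambda>kl. fst z ^ i * snd z ^ j * power_terms c z kl) has_sum fst z ^ i * snd z ^ j * s) UNIV"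
    by (rule has_sum_cmult_right[OF assms])
  also have "(\<lambda>kl. fst z ^ i * snd z ^ j * power_terms c z kl) = power_terms (shift_coeffs i j c) z \<circ> ?h"
    by (auto simp: fun_eq_iff shift_coeffs_def power_add)
  also have "(\<dots> has_sum fst z ^ i * snd z ^ j * s) UNIV \<longleftrightarrow>
      (power_terms (shift_coeffs i j c) z has_sum fst z ^ i * snd z ^ j * s) (range ?h)"
    by (rule has_sum_reindex[symmetric]) (auto simp: inj_on_def)
  also have "\<dots> \<longleftrightarrow> ?thesis"
  proof (rule has_sum_cong_neutral)
    fix kl assume *: "kl \<in> UNIV - range ?h"
    obtain k l where kl: "kl = (k, l)" by (cases kl)
    have "\<not> (i \<le> k \<and> j \<le> l)"
    proof
      assume "i \<le> k \<and> j \<le> l"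
      then have "kl = ?h (k - i, l - j)" by (simp add: kl)
      with * show False by blast
    qed
    then show "power_terms (shift_coeffs i j c) z kl = 0" by (auto simp: kl shift_coeffs_def)
  qed auto
  finally show ?thesis .
qed

lemma abs_shift_coeffs_le: "(\<And>kl. \<bar>c kl\<bar> \<le> M * d kl) \<Longrightarrow> \<bar>shift_coeffs i j c kl\<bar> \<le> M * shift_coeffs i j d kl"
  by (auto simp: shift_coeffs_def split: prod.splits)

text \<open>Coefficients of \<open>((1 + 2 * x) * (1 + 2 * y)) ^ t\<close>.\<close>

primrec majorant :: "nat \<Rightarrow> nat \<times> nat \<Rightarrow> real" where
  "majorant 0 = (\<lambda>kl. if kl = (0, 0) then 1 else 0)"
| "majorant (Suc t) = (\<lambda>kl. \<Sum>i<2. \<Sum>j<2. 2 ^ (i + j) * shift_coeffs i j (majorant t) kl)"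

lemma has_sum_delta_00: "(power_terms (\<lambda>kl. if kl = (0, 0) then a else 0) z has_sum a) UNIV"
proof -
  have "(power_terms (\<lambda>kl. if kl = (0, 0) then a else 0) z has_sum a) {(0, 0)}"
    by (rule has_sum_finiteI) auto
  then show ?thesis
    by (rule has_sum_cong_neutral[THEN iffD1, rotated -1]) auto
qed

lemma has_sum_sum:
  fixes f :: "'i \<Rightarrow> 'x \<Rightarrow> real"
  assumes "\<And>i. i \<in> A \<Longrightarrow> (f i has_sum s i) X"
  shows "((\<lambda>x. \<Sum>i\<in>A. f i x) has_sum (\<Sum>i\<in>A. s i)) X"
  using assms by (induction A rule: infinite_finite_induct) (auto intro!: has_sum_add)

text \<open>The recursion multiplies by the sum of \<open>2 ^ (i + j) * x ^ i * y ^ j\<close> over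
  \<open>i, j < 2\<close>, which factors as \<open>(1 + 2 * x) * (1 + 2 * y)\<close>.\<close>

lemma majorant_has_sum:
  "(power_terms (majorant t) (x, y) has_sum ((1 + 2 * x) * (1 + 2 * y)) ^ t) UNIV"
proof (induction t)
  case 0
  then show ?case using has_sum_delta_00[of 1 "(x, y)"] by simp
next
  case (Suc t)
  have "((\<lambda>kl. \<Sum>i<2. \<Sum>j<2. 2 ^ (i + j) * power_terms (shift_coeffs i j (majorant t)) (x, y) kl) has_sum
      (\<Sum>i<2. \<Sum>j<2. 2 ^ (i + j) * (x ^ i * y ^ j * ((1 + 2 * x) * (1 + 2 * y)) ^ t))) UNIV"
    using has_sum_shift_coeffs[OF Suc.IH] by (intro has_sum_sum has_sum_cmult_right) simp
  also have "(\<lambda>kl. \<Sum>i<2. \<Sum>j<2. 2 ^ (i + j) * power_terms (shift_coeffs i j (majorant t)) (x, y) kl) =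
      power_terms (majorant (Suc t)) (x, y)"
    by (simp add: fun_eq_iff sum_distrib_right mult.assoc)
  also have "(\<Sum>i<2. \<Sum>j<2. 2 ^ (i + j) * (x ^ i * y ^ j * ((1 + 2 * x) * (1 + 2 * y)) ^ t)) =
      ((1 + 2 * x) * (1 + 2 * y)) ^ Suc t"
    by (simp add: numeral_2_eq_2 algebra_simps)
  finally show ?case .
qed

lemma majorant_nonneg: "0 \<le> majorant t kl"
  by (induction t arbitrary: kl) (auto simp: shift_coeffs_def intro!: sum_nonneg split: prod.splits)

text \<open>
  One step of the chain is the operator
  \<open>f \<mapsto> (\<lambda>h. \<Sum>i<2. \<Sum>j<2. x ^ i * y ^ j * (\<Sum>e. w i j h e * f (nx h e)))\<close>; the four
  operators without the powers of \<open>x\<close> and \<open>y\<close> have sup-norm at most \<open>2 ^ (i + j)\<close>.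
\<close>

locale perturbed_chain =
  fixes w :: "nat \<Rightarrow> nat \<Rightarrow> 'h \<Rightarrow> 'i::finite \<Rightarrow> real" and nx :: "'h \<Rightarrow> 'i \<Rightarrow> 'h"
    and r :: "'h \<Rightarrow> real" and M :: real
  assumes w_bound: "\<And>i j h. i < 2 \<Longrightarrow> j < 2 \<Longrightarrow> (\<Sum>x\<in>UNIV. \<bar>w i j h x\<bar>) \<le> 2 ^ (i + j)"
    and r_bound: "\<And>h. \<bar>r h\<bar> \<le> M"
begin

primrec val :: "real \<times> real \<Rightarrow> nat \<Rightarrow> 'h \<Rightarrow> real" where
  "val z 0 h = r h"
| "val z (Suc t) h = (\<Sum>i<2. \<Sum>j<2. \<Sum>x\<in>UNIV. w i j h x * (fst z ^ i * snd z ^ j * val z t (nx h x)))"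

text \<open>The recursion of \<open>val\<close> carried out on coefficients, with monomial factors
  turned into shifts. As \<open>z\<close> does not occur, the resulting series has coefficients
  independent of the noise levels.\<close>

primrec coeff :: "nat \<Rightarrow> 'h \<Rightarrow> nat \<times> nat \<Rightarrow> real" where
  "coeff 0 h = (\<lambda>kl. if kl = (0, 0) then r h else 0)"
| "coeff (Suc t) h = (\<lambda>kl. \<Sum>i<2. \<Sum>j<2. \<Sum>x\<in>UNIV. w i j h x * shift_coeffs i j (coeff t (nx h x)) kl)"

lemma coeff_has_sum: "(power_terms (coeff t h) z has_sum val z t h) UNIV"
proof (induction t arbitrary: h)
  case 0
  then show ?case using has_sum_delta_00[of "r h" z] by simp
next
  case (Suc t)
  have "((\<lambda>kl. \<Sum>i<2. \<Sum>j<2. \<Sum>x\<in>UNIV. w i j h x * power_terms (shift_coeffs i j (coeff t (nx h x))) z kl) has_sum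
      val z (Suc t) h) UNIV"
    unfolding val.simps by (intro has_sum_sum has_sum_cmult_right has_sum_shift_coeffs Suc.IH)
  also have "(\<lambda>kl. \<Sum>i<2. \<Sum>j<2. \<Sum>x\<in>UNIV. w i j h x * power_terms (shift_coeffs i j (coeff t (nx h x))) z kl) =
      power_terms (coeff (Suc t) h) z"
    by (simp add: fun_eq_iff sum_distrib_right mult.assoc)
  finally show ?case .
qed

lemma M_nonneg: "0 \<le> M"
  using r_bound[of undefined] by linarith

text \<open>At each step \<open>w_bound\<close> contributes exactly the factor
  \<open>2 ^ (i + j)\<close> that the recursion of \<open>majorant\<close> contains.\<close>

lemma coeff_bound: "\<bar>coeff t h kl\<bar> \<le> M * majorant t kl"
proof (induction t arbitrary: h kl)
  case 0
  then show ?case using r_bound by simp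
next
  case (Suc t)
  have "\<bar>coeff (Suc t) h kl\<bar> \<le>
      (\<Sum>i<2. \<Sum>j<2. \<Sum>x\<in>UNIV. \<bar>w i j h x\<bar> * \<bar>shift_coeffs i j (coeff t (nx h x)) kl\<bar>)"
    unfolding coeff.simps abs_mult[symmetric]
    by (intro order.trans[OF sum_abs] sum_mono order.refl)
  also have "\<dots> \<le> (\<Sum>i<2. \<Sum>j<2. \<Sum>x\<in>UNIV. \<bar>w i j h x\<bar> * (M * shift_coeffs i j (majorant t) kl))"
    by (intro sum_mono mult_left_mono abs_shift_coeffs_le Suc.IH abs_ge_zero)
  also have "\<dots> \<le> (\<Sum>i<2. \<Sum>j<2. 2 ^ (i + j) * (M * shift_coeffs i j (majorant t) kl))"
  proof (intro sum_mono)
    fix i j :: nat assume "i \<in> {..<2}" "j \<in> {..<2}"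
    moreover have "0 \<le> M * shift_coeffs i j (majorant t) kl"
      using M_nonneg majorant_nonneg by (auto simp: shift_coeffs_def split: prod.splits)
    ultimately show "(\<Sum>x\<in>UNIV. \<bar>w i j h x\<bar> * (M * shift_coeffs i j (majorant t) kl)) \<le> 2 ^ (i + j) * (M * shift_coeffs i j (majorant t) kl)"
      unfolding sum_distrib_right[symmetric] by (intro mult_right_mono w_bound) auto
  qed
  also have "\<dots> = M * majorant (Suc t) kl"
    by (simp add: sum_distrib_left mult_ac)
  finally show ?case .
qed

lemma power_terms_coeff_bound:
  assumes "0 \<le> x" "0 \<le> y"
  shows "\<bar>power_terms (coeff t h) (x, y) kl\<bar> \<le> M * power_terms (majorant t) (x, y) kl"
proof -
  have "\<bar>power_terms (coeff t h) (x, y) kl\<bar> = \<bar>coeff t h kl\<bar> * (x ^ fst kl * y ^ snd kl)"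
    using assms by (simp add: abs_mult)
  also have "\<dots> \<le> (M * majorant t kl) * (x ^ fst kl * y ^ snd kl)"
    using assms by (intro mult_right_mono coeff_bound) auto
  finally show ?thesis by (simp add: mult.assoc)
qed

text \<open>This estimate grows with \<open>t\<close>, but it supplies the boundedness required to
  compute expectations of \<open>val\<close> before \<open>val\<close> itself is recognised as an
  expected reward.\<close>

lemma val_bound:
  assumes "0 \<le> x" "0 \<le> y"
  shows "\<bar>val (x, y) t h\<bar> \<le> M * ((1 + 2 * x) * (1 + 2 * y)) ^ t"
  using norm_infsum_le[OF coeff_has_sum has_sum_cmult_right[OF majorant_has_sum]]
    power_terms_coeff_bound[OF assms] by simp

section \<open>Summation over time\<close>

definition series_coeff :: "real \<Rightarrow> 'h \<Rightarrow> nat \<times> nat \<Rightarrow> real" where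
  "series_coeff \<beta> h kl = (\<Sum>t. \<beta> ^ t * coeff t h kl)"

text \<open>Fubini for the family indexed by time and exponents: summing over exponents first gives
  the discounted values, over time first the terms of \<open>series_coeff\<close>. Absolute
  summability comes from \<open>majorant\<close>, whose contribution at time \<open>t\<close> is
  \<open>M * (\<beta> * q) ^ t\<close>, a convergent geometric series.\<close>

lemma series_coeff_has_sum:
  assumes xy: "0 < x" "0 < y" and \<beta>: "0 \<le> \<beta>" "\<beta> * ((1 + 2 * x) * (1 + 2 * y)) < 1"
  shows "(power_terms (series_coeff \<beta> h) (x, y) has_sum (\<Sum>t. \<beta> ^ t * val (x, y) t h)) UNIV"
proof -
  define q where "q = (1 + 2 * x) * (1 + 2 * y)"
  have q: "0 \<le> q" using xy by (simp add: q_def)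
  define F where "F = (\<lambda>(t, kl). \<beta> ^ t * power_terms (coeff t h) (x, y) kl)"
  define G where "G = (\<lambda>(t, kl). \<beta> ^ t * (M * power_terms (majorant t) (x, y) kl))"
  have G_nonneg: "0 \<le> G tkl" for tkl
    using xy \<beta>(1) M_nonneg majorant_nonneg by (auto simp: G_def split: prod.splits)
  have "(G summable_on Sigma UNIV (\<lambda>_. UNIV))"
  proof (rule summable_on_SigmaI)
    show "((\<lambda>kl. G (t, kl)) has_sum (\<beta> ^ t * (M * q ^ t))) UNIV" for t
      unfolding G_def prod.case q_def by (intro has_sum_cmult_right majorant_has_sum)
    have "summable (\<lambda>t. M * (\<beta> * q) ^ t)"
      using \<beta> q by (intro summable_mult summable_geometric) (simp add: q_def)
    then have "summable (\<lambda>t. \<beta> ^ t * (M * q ^ t))"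
      by (simp add: power_mult_distrib mult_ac)
    then show "(\<lambda>t. \<beta> ^ t * (M * q ^ t)) summable_on UNIV"
      using \<beta>(1) q M_nonneg by (subst summable_on_UNIV_nonneg_real_iff) auto
  qed (rule G_nonneg)
  then have "(\<lambda>tkl. norm (F tkl)) summable_on UNIV"
    unfolding UNIV_Times_UNIV
  proof (rule summable_on_comparison_test)
    fix tkl :: "nat \<times> nat \<times> nat"
    show "norm (F tkl) \<le> G tkl"
      using \<beta>(1) power_terms_coeff_bound[of x y] xy
      by (auto simp: F_def G_def abs_mult split: prod.splits simp del: fst_conv snd_conv intro!: mult_left_mono)
  qed (rule norm_ge_zero)
  then have "F summable_on UNIV" by (rule summable_on_iff_abs_summable_on_real[THEN iffD2])
  then obtain S where S: "(F has_sum S) (UNIV \<times> UNIV)"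
    unfolding summable_on_def UNIV_Times_UNIV by blast
  have "((\<lambda>t. \<beta> ^ t * val (x, y) t h) has_sum S) UNIV"
  proof (rule has_sum_SigmaD[OF S])
    show "((\<lambda>kl. F (t, kl)) has_sum \<beta> ^ t * val (x, y) t h) UNIV" for t
      unfolding F_def prod.case by (intro has_sum_cmult_right coeff_has_sum)
  qed
  then have S_eq: "(\<Sum>t. \<beta> ^ t * val (x, y) t h) = S"
    using has_sum_imp_sums sums_unique by metis
  have S': "((\<lambda>(kl, t). F (t, kl)) has_sum S) (UNIV \<times> UNIV)"
    using S by (subst (asm) has_sum_swap)
  have "(power_terms (series_coeff \<beta> h) (x, y) has_sum S) UNIV"
  proof (rule has_sum_SigmaD[OF S'])
    fix kl :: "nat \<times> nat"
    \<comment> \<open>The monomial is nonzero as \<open>x\<close> and \<open>y\<close> are positive;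
      dividing by it shows that the series defining \<open>series_coeff\<close> converges.\<close>
    define m where "m = x ^ fst kl * y ^ snd kl"
    have "m \<noteq> 0" using xy by (simp add: m_def)
    have "(\<lambda>t. F (t, kl)) summable_on UNIV"
      using summable_on_SigmaD1[OF has_sum_imp_summable[OF S'], of kl] by simp
    then obtain s where s: "((\<lambda>t. F (t, kl)) has_sum s) UNIV" unfolding summable_on_def by blast
    have "(\<lambda>t. \<beta> ^ t * coeff t h kl * m) sums (s / m * m)"
      using has_sum_imp_sums[OF s] \<open>m \<noteq> 0\<close> by (simp add: F_def m_def mult.assoc)
    then have "(\<lambda>t. \<beta> ^ t * coeff t h kl) sums (s / m)"
      using \<open>m \<noteq> 0\<close> sums_mult2_iff by blast
    then have "series_coeff \<beta> h kl = s / m"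
      by (simp add: series_coeff_def sums_iff)
    then have "s = power_terms (series_coeff \<beta> h) (x, y) kl"
      using \<open>m \<noteq> 0\<close> by (simp add: m_def)
    then show "((\<lambda>t. case (kl, t) of (kl, t) \<Rightarrow> F (t, kl)) has_sum power_terms (series_coeff \<beta> h) (x, y) kl) UNIV"
      using s by simp
  qed
  then show ?thesis by (simp only: S_eq)
qed

end


section \<open>The value function\<close>

lemma sum_UNIV_prod:
  "(\<Sum>x\<in>UNIV. f x) = (\<Sum>a\<in>UNIV. \<Sum>b\<in>UNIV. f (a::'a::finite, b::'b::finite))"
  unfolding UNIV_Times_UNIV[symmetric] sum.cartesian_product by simp

text \<open>The identity matrix for \<open>i = 0\<close> and \<sigma> minus the identity otherwise,
  that is, the coefficient matrices of \<open>message_prob\<close> as an affine function of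
  \<epsilon>.\<close>

definition deviation :: "nat \<Rightarrow> ('l \<Rightarrow> 'l pmf) \<Rightarrow> 'l \<Rightarrow> 'l \<Rightarrow> real" where
  "deviation i \<sigma> s z = (if i = 0 then 0 else pmf (\<sigma> s) z) + (if i = 0 then 1 else - 1) * of_bool (z = s)"

text \<open>The zero diagonal of \<sigma> lets one affine formula cover both cases of
  \<open>message_prob\<close>.\<close>

lemma message_prob_deviation:
  assumes "pmf (\<sigma> s) s = 0"
  shows "message_prob \<epsilon> \<sigma> s z = (\<Sum>i<2. \<epsilon> ^ i * deviation i \<sigma> s z)"
  using assms by (auto simp: message_prob_def deviation_def numeral_2_eq_2)

lemma sum_deviation:
  fixes s :: "'l::finite"
  shows "(\<Sum>z\<in>UNIV. deviation i \<sigma> s z) = (if i = 0 then 1 else 0)"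
  by (simp add: deviation_def sum.distrib sum_distrib_left[symmetric] sum_pmf_eq_1 of_bool_def sum.delta)

text \<open>A row of \<sigma> and a row of the identity each have sum \<open>1\<close>, so their
  difference has absolute sum at most \<open>2\<close>. This is the origin of the factors
  \<open>2\<close> in \<open>majorant\<close>.\<close>

lemma sum_abs_deviation:
  fixes s :: "'l::finite"
  assumes "i < 2"
  shows "(\<Sum>z\<in>UNIV. \<bar>deviation i \<sigma> s z\<bar>) \<le> 2 ^ i"
proof -
  have "(\<Sum>z\<in>UNIV. \<bar>deviation i \<sigma> s z\<bar>) \<le>
      (\<Sum>z\<in>UNIV. (if i = 0 then 0 else pmf (\<sigma> s) z) + of_bool (z = s))"
    by (intro sum_mono) (auto simp: deviation_def intro: order.trans[OF abs_triangle_ineq4])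
  also have "\<dots> = (if i = 0 then 1 else 2)"
    by (simp add: sum.distrib sum_pmf_eq_1 of_bool_def sum.delta)
  also have "\<dots> \<le> 2 ^ i" using assms by (cases i) auto
  finally show ?thesis .
qed

lemma pmf_message:
  fixes s :: "'l::finite"
  assumes "pmf (\<sigma> s) s = 0" "0 \<le> \<epsilon>" "\<epsilon> \<le> 1"
  shows "pmf (message \<epsilon> \<sigma> s) z = message_prob \<epsilon> \<sigma> s z"
  unfolding message_def
proof (rule pmf_embed_pmf)
  show nonneg: "0 \<le> message_prob \<epsilon> \<sigma> s z" for z
    using assms by (simp add: message_prob_def)
  have "(\<Sum>z\<in>UNIV. message_prob \<epsilon> \<sigma> s z) = (\<Sum>i<2. \<epsilon> ^ i * (\<Sum>z\<in>UNIV. deviation i \<sigma> s z))"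
    unfolding message_prob_deviation[of \<sigma> s, OF assms(1)] sum_distrib_left by (rule sum.swap)
  also have "\<dots> = 1" by (simp add: sum_deviation numeral_2_eq_2)
  finally show "(\<integral>\<^sup>+z. ennreal (message_prob \<epsilon> \<sigma> s z) \<partial>count_space UNIV) = 1"
    by (simp add: nn_integral_count_space_finite nonneg sum_ennreal)
qed

section \<open>One step of the chain on joint histories\<close>

lemma expectation_UNIV:
  fixes p :: "'a::finite pmf"
  shows "(\<integral>x. f x \<partial>measure_pmf p) = (\<Sum>x\<in>UNIV. pmf p x * f x :: real)"
  by (subst integral_measure_pmf_real[where A=UNIV]) (auto simp: mult.commute)

text \<open>All randomness of one step, gathered into one finite type that serves as the index type
  of \<open>perturbed_chain\<close>.\<close>

type_synonym ('l1, 'l2, 'f1, 'f2, 'aL, 'a1, 'a2) event =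
  "('aL, 'a1, 'a2) action \<times> ('l1, 'l2, 'f1, 'f2) state \<times> ('l2 \<times> 'l1)"

text \<open>The coefficient of \<open>\<epsilon>1 ^ i * \<epsilon>2 ^ j\<close> in the probability
  of the event. It may be negative unless \<open>i = j = 0\<close>.\<close>

definition event_weight ::
    "('l1, 'l2, 'f1, 'f2, 'aL, 'a1, 'a2) game \<Rightarrow> ('l1, 'l2, 'f1, 'f2, 'aL, 'a1, 'a2) policies \<Rightarrow>
     nat \<Rightarrow> nat \<Rightarrow> ('l1, 'l2, 'f1, 'f2, 'aL, 'a1, 'a2) joint_history \<Rightarrow>
     ('l1, 'l2, 'f1, 'f2, 'aL, 'a1, 'a2) event \<Rightarrow> real" where
  "event_weight G \<delta> i j \<zeta> = (\<lambda>(a, s', z1, z2).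
     pmf (joint_policy \<delta> \<zeta>) a * (pmf (transition G (current_state \<zeta>) a) s' *
       (deviation i (noise_1 G) (snd (fst s')) z1 * deviation j (noise_2 G) (fst (fst s')) z2)))"

definition event_history ::
    "('l1, 'l2, 'f1, 'f2, 'aL, 'a1, 'a2) joint_history \<Rightarrow>
     ('l1, 'l2, 'f1, 'f2, 'aL, 'a1, 'a2) event \<Rightarrow>
     ('l1, 'l2, 'f1, 'f2, 'aL, 'a1, 'a2) joint_history" where
  "event_history \<zeta> = (\<lambda>(a, s', z'). next_history \<zeta> a s' z')"

definition expected_reward_L ::
    "('l1, 'l2, 'f1, 'f2, 'aL, 'a1, 'a2) game \<Rightarrow> ('l1, 'l2, 'f1, 'f2, 'aL, 'a1, 'a2) policies \<Rightarrow>
     ('l1, 'l2, 'f1, 'f2, 'aL, 'a1, 'a2) joint_history \<Rightarrow> real" where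
  "expected_reward_L G \<delta> \<zeta> = (\<integral>a. reward_L G (current_state \<zeta>) a \<partial>joint_policy \<delta> \<zeta>)"

definition reward_bound ::
    "('l1, 'l2, 'f1, 'f2, 'aL, 'a1, 'a2) game \<Rightarrow> real" where
  "reward_bound G = (SUP (s, a)\<in>UNIV. \<bar>reward_L G s a\<bar>)"

lemma reward_bound:
  fixes G :: "('l1::finite, 'l2::finite, 'f1::finite, 'f2::finite,
               'aL::finite, 'a1::finite, 'a2::finite) game"
  shows "\<bar>reward_L G s a\<bar> \<le> reward_bound G"
  unfolding reward_bound_def
  by (rule cSUP_upper2[where x="(s, a)"]) (auto intro!: bdd_above_finite)

text \<open>Policy and transition probabilities sum to one, so only the two rows of deviations
  contribute, by \<open>2 ^ i\<close> and \<open>2 ^ j\<close>.\<close>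

lemma sum_abs_event_weight:
  fixes G :: "('l1::finite, 'l2::finite, 'f1::finite, 'f2::finite,
               'aL::finite, 'a1::finite, 'a2::finite) game"
  assumes "i < 2" "j < 2"
  shows "(\<Sum>e\<in>UNIV. \<bar>event_weight G \<delta> i j \<zeta> e\<bar>) \<le> 2 ^ (i + j)"
proof -
  let ?p = "joint_policy \<delta> \<zeta>" and ?q = "transition G (current_state \<zeta>)"
  let ?d1 = "\<lambda>s'. \<Sum>z\<in>UNIV. \<bar>deviation i (noise_1 G) (snd (fst s')) z\<bar>"
  let ?d2 = "\<lambda>s'. \<Sum>z\<in>UNIV. \<bar>deviation j (noise_2 G) (fst (fst s')) z\<bar>"
  have "(\<Sum>e\<in>UNIV. \<bar>event_weight G \<delta> i j \<zeta> e\<bar>) =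
      (\<Sum>a\<in>UNIV. pmf ?p a * (\<Sum>s'\<in>UNIV. pmf (?q a) s' * (?d1 s' * ?d2 s')))"
    unfolding sum_product
    by (subst sum_UNIV_prod, rule sum.cong[OF refl], subst sum_UNIV_prod, subst sum_distrib_left,
        rule sum.cong[OF refl], subst sum_UNIV_prod)
       (simp add: event_weight_def abs_mult sum_distrib_left)
  also have "\<dots> \<le> (\<Sum>a\<in>UNIV. pmf ?p a * (\<Sum>s'\<in>UNIV. pmf (?q a) s' * (2 ^ i * 2 ^ j)))"
    by (intro sum_mono mult_left_mono mult_mono sum_abs_deviation assms) (auto intro: sum_nonneg)
  also have "\<dots> = 2 ^ (i + j)"
    by (simp add: sum_distrib_right[symmetric] sum_pmf_eq_1 power_add)
  finally show ?thesis .
qed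

lemma abs_expected_reward_L:
  fixes G :: "('l1::finite, 'l2::finite, 'f1::finite, 'f2::finite,
               'aL::finite, 'a1::finite, 'a2::finite) game"
  shows "\<bar>expected_reward_L G \<delta> \<zeta>\<bar> \<le> reward_bound G"
proof -
  have "\<bar>expected_reward_L G \<delta> \<zeta>\<bar> \<le> (\<Sum>a\<in>UNIV. \<bar>pmf (joint_policy \<delta> \<zeta>) a * reward_L G (current_state \<zeta>) a\<bar>)"
    unfolding expected_reward_L_def expectation_UNIV by (rule sum_abs)
  also have "\<dots> \<le> (\<Sum>a\<in>UNIV. pmf (joint_policy \<delta> \<zeta>) a * reward_bound G)"
    by (intro sum_mono) (simp add: abs_mult reward_bound mult_left_mono)
  also have "\<dots> = reward_bound G"
    unfolding sum_distrib_right[symmetric] by (simp add: sum_pmf_eq_1)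
  finally show ?thesis .
qed

text \<open>Independence makes the joint message probability a product of two affine functions;
  expanding it gives the four terms, and the rest interchanges finite sums.\<close>

lemma expectation_next_messages:
  fixes G :: "('l1::finite, 'l2::finite, 'f1::finite, 'f2::finite,
               'aL::finite, 'a1::finite, 'a2::finite) game"
  assumes "valid_game G" "\<epsilon>1 \<in> {0..1}" "\<epsilon>2 \<in> {0..1}"
  shows "(\<integral>z. f z \<partial>next_messages G \<epsilon>1 \<epsilon>2 s') = (\<Sum>i<2. \<Sum>j<2. \<Sum>z1\<in>UNIV. \<Sum>z2\<in>UNIV.
     deviation i (noise_1 G) (snd (fst s')) z1 * deviation j (noise_2 G) (fst (fst s')) z2 *
     (\<epsilon>1 ^ i * \<epsilon>2 ^ j * f (z1, z2)))"
proof -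
  obtain l1 l2 sF where s': "s' = ((l1, l2), sF)" by (metis prod.collapse)
  have pmf: "pmf (message \<epsilon>1 (noise_1 G) l2) z1 = (\<Sum>i<2. \<epsilon>1 ^ i * deviation i (noise_1 G) l2 z1)"
    "pmf (message \<epsilon>2 (noise_2 G) l1) z2 = (\<Sum>j<2. \<epsilon>2 ^ j * deviation j (noise_2 G) l1 z2)" for z1 z2
    using assms by (simp_all add: valid_game_def pmf_message message_prob_deviation)
  have "(\<integral>z. f z \<partial>next_messages G \<epsilon>1 \<epsilon>2 s') =
      (\<Sum>z1\<in>UNIV. \<Sum>z2\<in>UNIV. \<Sum>i<2. \<Sum>j<2.
        deviation i (noise_1 G) l2 z1 * deviation j (noise_2 G) l1 z2 * (\<epsilon>1 ^ i * \<epsilon>2 ^ j * f (z1, z2)))"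
    unfolding s' next_messages_def prod.case expectation_UNIV sum_UNIV_prod pmf_pair pmf sum_product
      sum_distrib_right
    by (intro sum.cong refl) (simp add: sum_distrib_left mult_ac)
  also have "\<dots> = (\<Sum>z1\<in>UNIV. \<Sum>i<2. \<Sum>j<2. \<Sum>z2\<in>UNIV.
        deviation i (noise_1 G) l2 z1 * deviation j (noise_2 G) l1 z2 * (\<epsilon>1 ^ i * \<epsilon>2 ^ j * f (z1, z2)))"
    by (intro sum.cong refl, subst sum.swap, intro sum.cong refl sum.swap)
  also have "\<dots> = (\<Sum>i<2. \<Sum>j<2. \<Sum>z1\<in>UNIV. \<Sum>z2\<in>UNIV.
        deviation i (noise_1 G) l2 z1 * deviation j (noise_2 G) l1 z2 * (\<epsilon>1 ^ i * \<epsilon>2 ^ j * f (z1, z2)))"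
    by (subst sum.swap, intro sum.cong refl sum.swap)
  finally show ?thesis by (simp add: s')
qed

text \<open>The transition law of the chain on histories alone, with the current action averaged
  out.\<close>

definition next_law ::
    "('l1, 'l2, 'f1, 'f2, 'aL, 'a1, 'a2) game \<Rightarrow> ('l1, 'l2, 'f1, 'f2, 'aL, 'a1, 'a2) policies \<Rightarrow>
     real \<Rightarrow> real \<Rightarrow> ('l1, 'l2, 'f1, 'f2, 'aL, 'a1, 'a2) joint_history \<Rightarrow>
     ('l1, 'l2, 'f1, 'f2, 'aL, 'a1, 'a2) joint_history pmf" where
  "next_law G \<delta> \<epsilon>1 \<epsilon>2 \<zeta> =
     bind_pmf (joint_policy \<delta> \<zeta>) (\<lambda>a.
     bind_pmf (transition G (current_state \<zeta>) a) (\<lambda>s'.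
     map_pmf (next_history \<zeta> a s') (next_messages G \<epsilon>1 \<epsilon>2 s')))"

text \<open>This intertwining replaces the chain on pairs of history and action by the chain on
  histories, the action being drawn last.\<close>

lemma bind_act_step:
  "bind_pmf (bind_pmf y (act \<delta>)) (step G \<delta> \<epsilon>1 \<epsilon>2) = bind_pmf (bind_pmf y (next_law G \<delta> \<epsilon>1 \<epsilon>2)) (act \<delta>)"
  by (simp add: bind_assoc_pmf act_def step_def next_law_def bind_map_pmf)

text \<open>This brings the transition into the operator form on which
  \<open>perturbed_chain\<close> is built.\<close>

lemma expectation_next_law:
  fixes G :: "('l1::finite, 'l2::finite, 'f1::finite, 'f2::finite,
               'aL::finite, 'a1::finite, 'a2::finite) game"
  assumes "valid_game G" "\<epsilon>1 \<in> {0..1}" "\<epsilon>2 \<in> {0..1}" and f: "\<And>\<zeta>. \<bar>f \<zeta>\<bar> \<le> B"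
  shows "(\<integral>\<zeta>'. f \<zeta>' \<partial>next_law G \<delta> \<epsilon>1 \<epsilon>2 \<zeta>) =
    (\<Sum>i<2. \<Sum>j<2. \<Sum>e\<in>UNIV. event_weight G \<delta> i j \<zeta> e * (\<epsilon>1 ^ i * \<epsilon>2 ^ j * f (event_history \<zeta> e)))"
proof -
  let ?p = "joint_policy \<delta> \<zeta>" and ?q = "transition G (current_state \<zeta>)"
  let ?t = "\<lambda>i j a s' z1 z2. pmf ?p a * (pmf (?q a) s' *
    (deviation i (noise_1 G) (snd (fst s')) z1 * deviation j (noise_2 G) (fst (fst s')) z2 *
     (\<epsilon>1 ^ i * \<epsilon>2 ^ j * f (next_history \<zeta> a s' (z1, z2)))))"
  have "(\<integral>\<zeta>'. f \<zeta>' \<partial>next_law G \<delta> \<epsilon>1 \<epsilon>2 \<zeta>) =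
      (\<Sum>a\<in>UNIV. \<Sum>s'\<in>UNIV. \<Sum>i<2. \<Sum>j<2. \<Sum>z1\<in>UNIV. \<Sum>z2\<in>UNIV. ?t i j a s' z1 z2)"
    unfolding next_law_def integral_bind_pmf_bounded[OF f] integral_map_pmf
      expectation_next_messages[OF assms(1-3)]
    unfolding expectation_UNIV sum_distrib_left ..
  also have "\<dots> = (\<Sum>a\<in>UNIV. \<Sum>i<2. \<Sum>j<2. \<Sum>s'\<in>UNIV. \<Sum>z1\<in>UNIV. \<Sum>z2\<in>UNIV. ?t i j a s' z1 z2)"
    by (intro sum.cong refl, subst sum.swap, intro sum.cong refl sum.swap)
  also have "\<dots> = (\<Sum>i<2. \<Sum>j<2. \<Sum>a\<in>UNIV. \<Sum>s'\<in>UNIV. \<Sum>z1\<in>UNIV. \<Sum>z2\<in>UNIV. ?t i j a s' z1 z2)"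
    by (subst sum.swap, intro sum.cong refl sum.swap)
  also have "\<dots> = (\<Sum>i<2. \<Sum>j<2. \<Sum>e\<in>UNIV. event_weight G \<delta> i j \<zeta> e * (\<epsilon>1 ^ i * \<epsilon>2 ^ j * f (event_history \<zeta> e)))"
    \<comment> \<open>The type annotations restrict the splitting to events; an unrestricted rewrite
      would also split the sums over actions and states.\<close>
    unfolding sum_UNIV_prod[where f="\<lambda>e :: ('l1, 'l2, 'f1, 'f2, 'aL, 'a1, 'a2) event. _ e"]
      sum_UNIV_prod[where f="\<lambda>e :: ('l1, 'l2, 'f1, 'f2) state \<times> 'l2 \<times> 'l1. _ e"]
      sum_UNIV_prod[where f="\<lambda>e :: 'l2 \<times> 'l1. _ e"]
    by (simp add: event_weight_def event_history_def mult.assoc)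
  finally show ?thesis .
qed

lemma abs_expectation_le:
  fixes f :: "'a \<Rightarrow> real"
  assumes "\<And>x. \<bar>f x\<bar> \<le> B"
  shows "\<bar>\<integral>x. f x \<partial>measure_pmf p\<bar> \<le> B"
proof -
  have int: "integrable (measure_pmf p) (\<lambda>x. \<bar>f x\<bar>)"
    by (rule measure_pmf.integrable_const_bound[where B=B]) (use assms in auto)
  have "\<bar>\<integral>x. f x \<partial>measure_pmf p\<bar> \<le> (\<integral>x. \<bar>f x\<bar> \<partial>measure_pmf p)" by (rule integral_abs_bound)
  also have "\<dots> \<le> B" using assms by (intro measure_pmf.integral_le_const int) auto
  finally show ?thesis .
qed

lemma finite_histories: "finite (histories n :: ('s::finite, 'z::finite, 'a::finite) history set)"
proof (rule finite_subset)
  let ?L = "\<lambda>A. {xs. set xs \<subseteq> A \<and> length xs = n}"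
  show "(histories n :: ('s, 'z, 'a) history set) \<subseteq> ?L UNIV \<times> ?L UNIV \<times> ?L UNIV"
    by (auto simp: histories_def)
  show "finite (?L (UNIV :: 's set) \<times> ?L (UNIV :: 'z set) \<times> ?L (UNIV :: 'a set))"
    by (intro finite_cartesian_product finite_lists_length_eq finite)
qed

section \<open>The value as a belief average of discounted stage values\<close>

lemma perturbed_chain_game:
  fixes G :: "('l1::finite, 'l2::finite, 'f1::finite, 'f2::finite,
               'aL::finite, 'a1::finite, 'a2::finite) game"
  shows "perturbed_chain (event_weight G \<delta>) (expected_reward_L G \<delta>) (reward_bound G)"
  by unfold_locales (auto simp: sum_abs_event_weight abs_expected_reward_L)

text \<open>The leader's expected reward at time \<open>t\<close>, given by the recursion of the
  locale so that its polynomial form in the noise levels is immediate;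
  \<open>expectation_reward_L\<close> identifies it with the expectation.\<close>

definition stage_value_L ::
    "('l1::finite, 'l2::finite, 'f1::finite, 'f2::finite, 'aL::finite, 'a1::finite, 'a2::finite) game \<Rightarrow>
     ('l1, 'l2, 'f1, 'f2, 'aL, 'a1, 'a2) policies \<Rightarrow> real \<times> real \<Rightarrow> nat \<Rightarrow>
     ('l1, 'l2, 'f1, 'f2, 'aL, 'a1, 'a2) joint_history \<Rightarrow> real" where
  "stage_value_L G \<delta> = perturbed_chain.val (event_weight G \<delta>) event_history (expected_reward_L G \<delta>)"

definition discounted_value_L ::
    "('l1::finite, 'l2::finite, 'f1::finite, 'f2::finite, 'aL::finite, 'a1::finite, 'a2::finite) game \<Rightarrow>
     ('l1, 'l2, 'f1, 'f2, 'aL, 'a1, 'a2) policies \<Rightarrow> real \<times> real \<Rightarrow>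
     ('l1, 'l2, 'f1, 'f2, 'aL, 'a1, 'a2) joint_history \<Rightarrow> real" where
  "discounted_value_L G \<delta> z \<zeta> = (\<Sum>t. discount G ^ t * stage_value_L G \<delta> z t \<zeta>)"

context
  fixes G :: "('l1::finite, 'l2::finite, 'f1::finite, 'f2::finite,
               'aL::finite, 'a1::finite, 'a2::finite) game"
    and \<delta> :: "('l1, 'l2, 'f1, 'f2, 'aL, 'a1, 'a2) policies"
  assumes valid: "valid_game G"
begin

interpretation chain: perturbed_chain "event_weight G \<delta>" event_history "expected_reward_L G \<delta>" "reward_bound G"
  by (rule perturbed_chain_game)

text \<open>The first transition is peeled off and absorbed into the initial law through
  \<open>bind_act_step\<close>; hence \<open>y\<close> varies in the induction.\<close>

lemma expectation_reward_L:
  assumes \<epsilon>: "\<epsilon>1 \<in> {0..1}" "\<epsilon>2 \<in> {0..1}"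
  shows "(\<integral>x. reward_L G (current_state (fst x)) (snd x)
      \<partial>((\<lambda>\<nu>. bind_pmf \<nu> (step G \<delta> \<epsilon>1 \<epsilon>2)) ^^ t) (bind_pmf y (act \<delta>))) =
    (\<integral>\<zeta>. stage_value_L G \<delta> (\<epsilon>1, \<epsilon>2) t \<zeta> \<partial>y)"
proof (induction t arbitrary: y)
  case 0
  have "(\<integral>x. reward_L G (current_state (fst x)) (snd x) \<partial>bind_pmf y (act \<delta>)) =
      (\<integral>\<zeta>. (\<integral>x. reward_L G (current_state (fst x)) (snd x) \<partial>act \<delta> \<zeta>) \<partial>y)"
    by (rule integral_bind_pmf_bounded) (rule reward_bound)
  also have "\<dots> = (\<integral>\<zeta>. stage_value_L G \<delta> (\<epsilon>1, \<epsilon>2) 0 \<zeta> \<partial>y)"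
    by (simp add: act_def expected_reward_L_def stage_value_L_def)
  finally show ?case by simp
next
  case (Suc t)
  have bd: "\<bar>stage_value_L G \<delta> (\<epsilon>1, \<epsilon>2) t \<zeta>\<bar> \<le>
      reward_bound G * ((1 + 2 * \<epsilon>1) * (1 + 2 * \<epsilon>2)) ^ t" for \<zeta>
    unfolding stage_value_L_def by (rule chain.val_bound) (use \<epsilon> in auto)
  have "(\<integral>x. reward_L G (current_state (fst x)) (snd x)
      \<partial>((\<lambda>\<nu>. bind_pmf \<nu> (step G \<delta> \<epsilon>1 \<epsilon>2)) ^^ Suc t) (bind_pmf y (act \<delta>))) =
      (\<integral>\<zeta>. stage_value_L G \<delta> (\<epsilon>1, \<epsilon>2) t \<zeta> \<partial>bind_pmf y (next_law G \<delta> \<epsilon>1 \<epsilon>2))"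
    by (simp only: funpow_Suc_right o_apply bind_act_step Suc.IH)
  also have "\<dots> = (\<integral>\<zeta>. (\<integral>\<zeta>'. stage_value_L G \<delta> (\<epsilon>1, \<epsilon>2) t \<zeta>' \<partial>next_law G \<delta> \<epsilon>1 \<epsilon>2 \<zeta>) \<partial>y)"
    by (rule integral_bind_pmf_bounded[OF bd])
  also have "\<dots> = (\<integral>\<zeta>. stage_value_L G \<delta> (\<epsilon>1, \<epsilon>2) (Suc t) \<zeta> \<partial>y)"
    unfolding expectation_next_law[OF valid \<epsilon> bd] by (simp add: stage_value_L_def)
  finally show ?case .
qed

text \<open>Read as an expected reward from a point mass, the stage value has a bound free of
  \<open>t\<close>. The discounted sum thus converges on the whole closed unit square of noise
  levels.\<close>

lemma abs_stage_value_L: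
  assumes "\<epsilon>1 \<in> {0..1}" "\<epsilon>2 \<in> {0..1}"
  shows "\<bar>stage_value_L G \<delta> (\<epsilon>1, \<epsilon>2) t \<zeta>\<bar> \<le> reward_bound G"
proof -
  have "stage_value_L G \<delta> (\<epsilon>1, \<epsilon>2) t \<zeta> = (\<integral>x. reward_L G (current_state (fst x)) (snd x)
      \<partial>((\<lambda>\<nu>. bind_pmf \<nu> (step G \<delta> \<epsilon>1 \<epsilon>2)) ^^ t) (bind_pmf (return_pmf \<zeta>) (act \<delta>)))"
    unfolding expectation_reward_L[OF assms] by simp
  also have "\<bar>\<dots>\<bar> \<le> reward_bound G" by (rule abs_expectation_le) (rule reward_bound)
  finally show ?thesis .
qed

lemma summable_discount: "summable (\<lambda>t. discount G ^ t * B)"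
  using valid by (intro summable_mult2 summable_geometric) (simp add: valid_game_def)

lemma summable_stage_value_L:
  assumes "\<epsilon>1 \<in> {0..1}" "\<epsilon>2 \<in> {0..1}"
  shows "summable (\<lambda>t. discount G ^ t * stage_value_L G \<delta> (\<epsilon>1, \<epsilon>2) t \<zeta>)"
  by (rule summable_comparison_test'[OF summable_discount[of "reward_bound G"]])
     (use valid in \<open>auto simp: valid_game_def abs_mult intro!: mult_left_mono abs_stage_value_L[OF assms]\<close>)

lemma finite_followers_histories: "finite (followers_histories G)"
  by (simp add: followers_histories_def finite_histories)

text \<open>Discounting dominates the rewards, so integral and sum over time commute; each integral
  then involves one marginal of the path, hence one stage value averaged over the belief.\<close>

lemma value_L_eq:
  assumes \<epsilon>: "\<epsilon>1 \<in> {0..1}" "\<epsilon>2 \<in> {0..1}" and y: "y \<in> beliefs G"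
  shows "value_L G \<delta> \<epsilon>1 \<epsilon>2 \<zeta>L y =
    (\<Sum>\<zeta>F\<in>followers_histories G. pmf y \<zeta>F * discounted_value_L G \<delta> (\<epsilon>1, \<epsilon>2) (\<zeta>L, \<zeta>F))"
proof -
  \<comment> \<open>The initial law in the form required by \<open>expectation_reward_L\<close>: a
    law of joint histories followed by \<open>act\<close>.\<close>
  define \<mu> where "\<mu> = bind_pmf (map_pmf (Pair \<zeta>L) y) (act \<delta>)"
  define K where "K = step G \<delta> \<epsilon>1 \<epsilon>2"
  define f :: "('l1, 'l2, 'f1, 'f2, 'aL, 'a1, 'a2) joint_history \<times> ('aL, 'a1, 'a2) action \<Rightarrow> real"
    where "f = (\<lambda>x. reward_L G (current_state (fst x)) (snd x))"
  have f: "\<bar>f x\<bar> \<le> reward_bound G" for x by (simp add: f_def reward_bound)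
  have \<beta>: "0 \<le> discount G" using valid by (simp add: valid_game_def)
  interpret P: prob_space "path_measure \<mu> K" by (rule prob_space_path_measure)
  have term_bound: "norm (discount G ^ t * f x) \<le> discount G ^ t * reward_bound G" for t x
    using f[of x] \<beta> by (simp add: abs_mult mult_left_mono)
  have meas: "(\<lambda>\<omega>. discount G ^ t * f (\<omega> t)) \<in> borel_measurable (path_measure \<mu> K)" for t
    by (rule measurable_path_measure) simp
  have "value_L G \<delta> \<epsilon>1 \<epsilon>2 \<zeta>L y = (\<integral>\<omega>. (\<Sum>t. discount G ^ t * f (\<omega> t)) \<partial>path_measure \<mu> K)"
    by (simp add: value_L_def f_def \<mu>_def K_def bind_map_pmf)
  also have "\<dots> = (\<Sum>t. \<integral>\<omega>. discount G ^ t * f (\<omega> t) \<partial>path_measure \<mu> K)"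
  proof (rule integral_suminf)
    show int: "integrable (path_measure \<mu> K) (\<lambda>\<omega>. discount G ^ t * f (\<omega> t))" for t
      by (rule P.integrable_const_bound[OF _ meas]) (use term_bound in blast)
    show "AE \<omega> in path_measure \<mu> K. summable (\<lambda>t. norm (discount G ^ t * f (\<omega> t)))"
      by (intro AE_I2 summable_comparison_test'[OF summable_discount[of "reward_bound G"]])
         (use term_bound in simp)
    have le: "(\<integral>\<omega>. norm (discount G ^ t * f (\<omega> t)) \<partial>path_measure \<mu> K) \<le> discount G ^ t * reward_bound G" for t
      by (intro P.integral_le_const integrable_norm int AE_I2 term_bound)
    show "summable (\<lambda>t. \<integral>\<omega>. norm (discount G ^ t * f (\<omega> t)) \<partial>path_measure \<mu> K)"
      by (rule summable_comparison_test'[OF summable_discount[of "reward_bound G"]])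
         (use le in \<open>simp add: integral_nonneg_AE\<close>)
  qed
  also have "\<dots> = (\<Sum>t. discount G ^ t * (\<integral>\<zeta>F. stage_value_L G \<delta> (\<epsilon>1, \<epsilon>2) t (\<zeta>L, \<zeta>F) \<partial>y))"
  proof (rule arg_cong[where f=suminf], rule ext)
    fix t
    have "(\<integral>\<omega>. f (\<omega> t) \<partial>path_measure \<mu> K) = (\<integral>\<zeta>F. stage_value_L G \<delta> (\<epsilon>1, \<epsilon>2) t (\<zeta>L, \<zeta>F) \<partial>y)"
      unfolding integral_path_measure unfolding f_def \<mu>_def K_def expectation_reward_L[OF \<epsilon>] by simp
    then show "(\<integral>\<omega>. discount G ^ t * f (\<omega> t) \<partial>path_measure \<mu> K) =
        discount G ^ t * (\<integral>\<zeta>F. stage_value_L G \<delta> (\<epsilon>1, \<epsilon>2) t (\<zeta>L, \<zeta>F) \<partial>y)"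
      by simp
  qed
  also have "\<dots> = (\<Sum>t. \<Sum>\<zeta>F\<in>followers_histories G.
      pmf y \<zeta>F * (discount G ^ t * stage_value_L G \<delta> (\<epsilon>1, \<epsilon>2) t (\<zeta>L, \<zeta>F)))"
    using y
    by (subst integral_measure_pmf_real[OF finite_followers_histories])
       (auto simp: beliefs_def sum_distrib_left mult_ac)
  also have "\<dots> = (\<Sum>\<zeta>F\<in>followers_histories G.
      \<Sum>t. pmf y \<zeta>F * (discount G ^ t * stage_value_L G \<delta> (\<epsilon>1, \<epsilon>2) t (\<zeta>L, \<zeta>F)))"
    by (intro suminf_sum summable_mult summable_stage_value_L \<epsilon>)
  also have "\<dots> = (\<Sum>\<zeta>F\<in>followers_histories G. pmf y \<zeta>F * discounted_value_L G \<delta> (\<epsilon>1, \<epsilon>2) (\<zeta>L, \<zeta>F))"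
    unfolding discounted_value_L_def
    by (intro sum.cong refl suminf_mult summable_stage_value_L \<epsilon>)
  finally show ?thesis .
qed

text \<open>A point mass on one followers' history is a belief for every leader history and reads
  off the value of \<open>g\<close> there. This forces uniqueness; existence is
  \<open>value_L_eq\<close>.\<close>

lemma represents_value_L_iff:
  assumes \<epsilon>: "\<epsilon>1 \<in> {0..1}" "\<epsilon>2 \<in> {0..1}"
  shows "represents_value_L G \<delta> \<epsilon>1 \<epsilon>2 g \<longleftrightarrow>
    (\<forall>\<zeta>\<in>joint_histories G. g \<zeta> = discounted_value_L G \<delta> (\<epsilon>1, \<epsilon>2) \<zeta>)"
proof
  assume rep: "represents_value_L G \<delta> \<epsilon>1 \<epsilon>2 g"
  show "\<forall>\<zeta>\<in>joint_histories G. g \<zeta> = discounted_value_L G \<delta> (\<epsilon>1, \<epsilon>2) \<zeta>"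
  proof
    fix \<zeta> assume "\<zeta> \<in> joint_histories G"
    then obtain \<zeta>L \<zeta>F where \<zeta>: "\<zeta> = (\<zeta>L, \<zeta>F)" "\<zeta>L \<in> leader_histories G" "\<zeta>F \<in> followers_histories G"
      by (auto simp: joint_histories_def)
    have point: "(\<Sum>\<xi>\<in>followers_histories G. pmf (return_pmf \<zeta>F) \<xi> * h \<xi>) = h \<zeta>F" for h
    proof -
      have "pmf (return_pmf \<zeta>F) \<xi> * h \<xi> = (if \<xi> = \<zeta>F then h \<xi> else 0)" for \<xi>
        by (simp add: indicator_def)
      then show ?thesis using finite_followers_histories \<zeta>(3) by simp
    qed
    have b: "return_pmf \<zeta>F \<in> beliefs G" using \<zeta>(3) by (simp add: beliefs_def)
    have "value_L G \<delta> \<epsilon>1 \<epsilon>2 \<zeta>L (return_pmf \<zeta>F) = g (\<zeta>L, \<zeta>F)"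
      using rep \<zeta>(2) b by (simp only: represents_value_L_def point)
    moreover have "value_L G \<delta> \<epsilon>1 \<epsilon>2 \<zeta>L (return_pmf \<zeta>F) = discounted_value_L G \<delta> (\<epsilon>1, \<epsilon>2) (\<zeta>L, \<zeta>F)"
      by (simp only: value_L_eq[OF \<epsilon> b] point)
    ultimately show "g \<zeta> = discounted_value_L G \<delta> (\<epsilon>1, \<epsilon>2) \<zeta>" by (simp only: \<zeta>(1))
  qed
next
  assume "\<forall>\<zeta>\<in>joint_histories G. g \<zeta> = discounted_value_L G \<delta> (\<epsilon>1, \<epsilon>2) \<zeta>"
  then show "represents_value_L G \<delta> \<epsilon>1 \<epsilon>2 g"
    by (auto simp: represents_value_L_def value_L_eq[OF \<epsilon>] joint_histories_def intro!: sum.cong)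
qed

text \<open>Functions on the set of joint histories are modelled by extensional ones, so that
  agreement on that set is equality.\<close>

lemma ex1_represents_value_L:
  assumes \<epsilon>: "\<epsilon>1 \<in> {0..1}" "\<epsilon>2 \<in> {0..1}"
  shows "\<exists>!g. g \<in> extensional (joint_histories G) \<and> represents_value_L G \<delta> \<epsilon>1 \<epsilon>2 g"
proof (rule ex1I)
  show "restrict (discounted_value_L G \<delta> (\<epsilon>1, \<epsilon>2)) (joint_histories G) \<in> extensional (joint_histories G) \<and>
      represents_value_L G \<delta> \<epsilon>1 \<epsilon>2 (restrict (discounted_value_L G \<delta> (\<epsilon>1, \<epsilon>2)) (joint_histories G))"
    by (simp add: represents_value_L_iff[OF \<epsilon>])
next
  fix g assume "g \<in> extensional (joint_histories G) \<and> represents_value_L G \<delta> \<epsilon>1 \<epsilon>2 g"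
  then show "g = restrict (discounted_value_L G \<delta> (\<epsilon>1, \<epsilon>2)) (joint_histories G)"
    by (intro extensionalityI[of _ "joint_histories G"]) (auto simp: represents_value_L_iff[OF \<epsilon>])
qed

lemma discounted_value_L_has_sum:
  assumes "0 < x" "0 < y" "discount G * ((1 + 2 * x) * (1 + 2 * y)) < 1"
  shows "(power_terms (chain.series_coeff (discount G) \<zeta>) (x, y) has_sum discounted_value_L G \<delta> (x, y) \<zeta>) UNIV"
  unfolding discounted_value_L_def stage_value_L_def
  by (rule chain.series_coeff_has_sum) (use assms valid in \<open>auto simp: valid_game_def\<close>)

text \<open>One coefficient family is fixed before \<open>x\<close> and \<open>y\<close>, in a form
  usable outside the interpretation.\<close>

lemma discounted_value_L_power_series:
  obtains a where "\<And>x y \<zeta>. 0 < x \<Longrightarrow> 0 < y \<Longrightarrow> discount G * ((1 + 2 * x) * (1 + 2 * y)) < 1 \<Longrightarrow>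
    (power_terms (a \<zeta>) (x, y) has_sum discounted_value_L G \<delta> (x, y) \<zeta>) UNIV"
  using discounted_value_L_has_sum by blast

end

text \<open>In the first range each factor is below \<open>3\<close>. In the second, the product
  expands to \<open>\<beta> + 2 * \<beta> * x + 2 * \<beta> * y + 4 * \<beta> * x * y\<close>; with
  \<open>x < 1\<close> the last three terms are at most
  \<open>2 * \<beta> * x + 6 * \<beta> * y\<close>, which is less than
  \<open>1 - \<beta>\<close>.\<close>

lemma discount_bound:
  fixes \<beta> x y :: real
  assumes "0 < \<beta>" "\<beta> < 1" "0 < x" "0 < y"
    and "\<beta> \<le> 1 / 9 \<and> x < 1 \<and> y < 1 \<or> 1 / 9 < \<beta> \<and> x < (1 - \<beta>) / (8 * \<beta>) \<and> y < (1 - \<beta>) / (8 * \<beta>)"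
  shows "\<beta> * ((1 + 2 * x) * (1 + 2 * y)) < 1"
  using assms(5)
proof
  assume *: "\<beta> \<le> 1 / 9 \<and> x < 1 \<and> y < 1"
  then have "(1 + 2 * x) * (1 + 2 * y) < 3 * 3"
    using assms by (intro mult_strict_mono) auto
  then have "\<beta> * ((1 + 2 * x) * (1 + 2 * y)) < \<beta> * 9"
    using assms by simp
  then show ?thesis using * by simp
next
  assume *: "1 / 9 < \<beta> \<and> x < (1 - \<beta>) / (8 * \<beta>) \<and> y < (1 - \<beta>) / (8 * \<beta>)"
  then have xy: "8 * (\<beta> * x) < 1 - \<beta>" "8 * (\<beta> * y) < 1 - \<beta>"
    using assms by (auto simp: field_simps)
  \<comment> \<open>The condition \<open>1 / 9 < \<beta>\<close> says exactly that
    \<open>1 - \<beta> < 8 * \<beta>\<close>.\<close>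
  then have "\<beta> * x < \<beta>" using * by linarith
  then have "x < 1" using assms by simp
  then have "\<beta> * (x * y) \<le> \<beta> * y"
    using assms by (intro mult_left_mono) auto
  with xy show ?thesis by (simp add: algebra_simps)
qed

text \<open>The coefficients are quantified before the noise levels, which expresses their
  independence; \<open>has_sum\<close> over pairs is unconditional convergence of the double
  series.\<close>

theorem theorem1:
  fixes G :: "('l1::finite, 'l2::finite, 'f1::finite, 'f2::finite,
               'aL::finite, 'a1::finite, 'a2::finite) game"
    and \<delta> :: "('l1, 'l2, 'f1, 'f2, 'aL, 'a1, 'a2) policies"
    and \<beta> :: real
    and R :: "(real \<times> real) set"
  assumes "valid_game G"
    and "\<beta> = discount G"
    and "R = {(\<epsilon>1, \<epsilon>2).
           0 < \<beta> \<and> \<beta> \<le> 1/9 \<and> 0 < \<epsilon>1 \<and> \<epsilon>1 < 1 \<and> 0 < \<epsilon>2 \<and> \<epsilon>2 < 1 \<or>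
           1/9 < \<beta> \<and> 0 < \<epsilon>1 \<and> \<epsilon>1 < (1 - \<beta>) / (8 * \<beta>) \<and> 0 < \<epsilon>2 \<and> \<epsilon>2 < (1 - \<beta>) / (8 * \<beta>)}"
  shows "(\<forall>\<epsilon>1\<in>{0..1}. \<forall>\<epsilon>2\<in>{0..1}.
            \<exists>!g. g \<in> extensional (joint_histories G) \<and> represents_value_L G \<delta> \<epsilon>1 \<epsilon>2 g) \<and>
         (\<exists>\<alpha> :: nat \<Rightarrow> nat \<Rightarrow> ('l1, 'l2, 'f1, 'f2, 'aL, 'a1, 'a2) joint_history \<Rightarrow> real.
            \<forall>(\<epsilon>1, \<epsilon>2)\<in>R. \<forall>g. represents_value_L G \<delta> \<epsilon>1 \<epsilon>2 g \<longrightarrow>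
              (\<forall>\<zeta>\<in>joint_histories G.
                 ((\<lambda>(k, l). \<epsilon>1 ^ k * \<epsilon>2 ^ l * \<alpha> k l \<zeta>) has_sum g \<zeta>) UNIV)) \<and>
         (\<forall>\<zeta>L\<in>leader_histories G. \<forall>y\<in>beliefs G.
            infinitely_differentiable_on R (\<lambda>(\<epsilon>1, \<epsilon>2). value_L G \<delta> \<epsilon>1 \<epsilon>2 \<zeta>L y))"
proof (intro conjI)
  have \<beta>: "0 \<le> \<beta>" "\<beta> < 1" using assms(1,2) by (auto simp: valid_game_def)
  \<comment> \<open>The side of the square \<open>R\<close>; the value \<open>0\<close> at
    \<open>\<beta> = 0\<close> makes the square empty, as \<open>R\<close> is then.\<close>
  define \<rho> where "\<rho> = (if \<beta> = 0 then 0 else if \<beta> \<le> 1/9 then 1 else (1 - \<beta>) / (8 * \<beta>))"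
  have R: "R = {0<..<\<rho>} \<times> {0<..<\<rho>}"
    using \<beta> by (auto simp: assms(3) \<rho>_def)
  \<comment> \<open>Keeps \<open>R\<close> inside the unit square, where the messages have the
    intended probabilities.\<close>
  have "\<rho> \<le> 1" using \<beta> by (auto simp: \<rho>_def field_simps)
  have unit: "\<epsilon>1 \<in> {0..1}" "\<epsilon>2 \<in> {0..1}" if "(\<epsilon>1, \<epsilon>2) \<in> R" for \<epsilon>1 \<epsilon>2
    using that \<open>\<rho> \<le> 1\<close> by (auto simp: R)
  obtain a where a: "\<And>x y \<zeta>. 0 < x \<Longrightarrow> 0 < y \<Longrightarrow> discount G * ((1 + 2 * x) * (1 + 2 * y)) < 1 \<Longrightarrow>
      (power_terms (a \<zeta>) (x, y) has_sum discounted_value_L G \<delta> (x, y) \<zeta>) UNIV"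
    using discounted_value_L_power_series[OF assms(1)] by blast
  have sum_R: "(power_terms (a \<zeta>) (\<epsilon>1, \<epsilon>2) has_sum discounted_value_L G \<delta> (\<epsilon>1, \<epsilon>2) \<zeta>) UNIV"
    if "(\<epsilon>1, \<epsilon>2) \<in> R" for \<epsilon>1 \<epsilon>2 \<zeta>
  proof (rule a)
    show "0 < \<epsilon>1" "0 < \<epsilon>2" using that by (auto simp: assms(3))
    show "discount G * ((1 + 2 * \<epsilon>1) * (1 + 2 * \<epsilon>2)) < 1"
      unfolding assms(2)[symmetric] by (rule discount_bound) (use that \<beta> in \<open>auto simp: assms(3)\<close>)
  qed
  show "\<forall>\<epsilon>1\<in>{0..1}. \<forall>\<epsilon>2\<in>{0..1}.
      \<exists>!g. g \<in> extensional (joint_histories G) \<and> represents_value_L G \<delta> \<epsilon>1 \<epsilon>2 g"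
    by (intro ballI ex1_represents_value_L assms(1))
  have "((\<lambda>(k, l). \<epsilon>1 ^ k * \<epsilon>2 ^ l * a \<zeta> (k, l)) has_sum g \<zeta>) UNIV"
    if "(\<epsilon>1, \<epsilon>2) \<in> R" "represents_value_L G \<delta> \<epsilon>1 \<epsilon>2 g" "\<zeta> \<in> joint_histories G" for \<epsilon>1 \<epsilon>2 g \<zeta>
  proof -
    have "g \<zeta> = discounted_value_L G \<delta> (\<epsilon>1, \<epsilon>2) \<zeta>"
      using that represents_value_L_iff[OF assms(1) unit[OF that(1)]] by blast
    then show ?thesis
      using sum_R[OF that(1), of \<zeta>] by (simp add: case_prod_unfold mult.commute)
  qed
  then show "\<exists>\<alpha> :: nat \<Rightarrow> nat \<Rightarrow> ('l1, 'l2, 'f1, 'f2, 'aL, 'a1, 'a2) joint_history \<Rightarrow> real.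
      \<forall>(\<epsilon>1, \<epsilon>2)\<in>R. \<forall>g. represents_value_L G \<delta> \<epsilon>1 \<epsilon>2 g \<longrightarrow>
        (\<forall>\<zeta>\<in>joint_histories G. ((\<lambda>(k, l). \<epsilon>1 ^ k * \<epsilon>2 ^ l * \<alpha> k l \<zeta>) has_sum g \<zeta>) UNIV)"
    by (intro exI[of _ "\<lambda>k l \<zeta>. a \<zeta> (k, l)"]) blast
  show "\<forall>\<zeta>L\<in>leader_histories G. \<forall>y\<in>beliefs G.
      infinitely_differentiable_on R (\<lambda>(\<epsilon>1, \<epsilon>2). value_L G \<delta> \<epsilon>1 \<epsilon>2 \<zeta>L y)"
  proof (intro ballI)
    fix \<zeta>L y assume y: "y \<in> beliefs G"
    \<comment> \<open>The belief average of the coefficients gives the power series of the value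
      itself.\<close>
    define b where "b = (\<lambda>kl. \<Sum>\<zeta>F\<in>followers_histories G. pmf y \<zeta>F * a (\<zeta>L, \<zeta>F) kl)"
    have b_sum: "(power_terms b (\<epsilon>1, \<epsilon>2) has_sum value_L G \<delta> \<epsilon>1 \<epsilon>2 \<zeta>L y) UNIV" if "(\<epsilon>1, \<epsilon>2) \<in> R" for \<epsilon>1 \<epsilon>2
    proof -
      have "((\<lambda>kl. \<Sum>\<zeta>F\<in>followers_histories G. pmf y \<zeta>F * power_terms (a (\<zeta>L, \<zeta>F)) (\<epsilon>1, \<epsilon>2) kl) has_sum
          value_L G \<delta> \<epsilon>1 \<epsilon>2 \<zeta>L y) UNIV"
        unfolding value_L_eq[OF assms(1) unit[OF that] y]
        by (intro has_sum_sum has_sum_cmult_right sum_R that)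
      then show ?thesis by (simp add: b_def sum_distrib_right mult.assoc)
    qed
    have conv: "convergent_on_square \<rho> b"
      unfolding convergent_on_square_def R[symmetric]
      using has_sum_imp_summable[OF b_sum] by auto
    have "value_L G \<delta> \<epsilon>1 \<epsilon>2 \<zeta>L y = power_sum b (\<epsilon>1, \<epsilon>2)" if "(\<epsilon>1, \<epsilon>2) \<in> R" for \<epsilon>1 \<epsilon>2
      using infsumI[OF b_sum[OF that]] by (simp add: power_sum_def)
    then have "n_times_differentiable_on R (\<lambda>(\<epsilon>1, \<epsilon>2). value_L G \<delta> \<epsilon>1 \<epsilon>2 \<zeta>L y) n \<longleftrightarrow>
        n_times_differentiable_on R (power_sum b) n" for n
      by (intro n_times_differentiable_on_cong) (auto simp: R intro!: open_Times)
    then show "infinitely_differentiable_on R (\<lambda>(\<epsilon>1, \<epsilon>2). value_L G \<delta> \<epsilon>1 \<epsilon>2 \<zeta>L y)"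
      using power_sum_infinitely_differentiable[OF conv]
      by (simp add: infinitely_differentiable_on_def R)
  qed
qed

end
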